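(* Let $\mathcal{K}_1,\mathcal{K}_2$ be complex Hilbert spaces and for $i=1,2$ let $W_i:\mathcal{K}_i\to\mathcal{B}(\mathcal{H}_i)$ be a cyclic vacuum representation of the canonical commutation relations (CCR) over $\mathcal{K}_i$ with cyclic vacuum vector $\Omega_i\in\mathcal{H}_i$. Let $\mathcal{W}_0(\mathcal{K}_i)$ be the linear span of $\{W_i(f): f\in\mathcal{K}_i\}$, let $\mathcal{W}(\mathcal{K}_i)$ be the von Neumann algebra generated by $\mathcal{W}_0(\mathcal{K}_i)$, and let $\varphi_i(A)=\langle\Omega_i, A\Omega_i\rangle$ be the vacuum state on $\mathcal{W}(\mathcal{K}_i)$. Let $C:\mathcal{K}_1\to\mathcal{K}_2$ be a linear contraction. Then: (i) the formula $$\Gamma_0(C)\bigl(W_1(f)\bigr):=e^{-\frac12(\|f\|^2-\|Cf\|^2)}\,W_2(Cf)\qquad(f\in\mathcal{K}_1)$$ determines by linearity, unambiguously, a linear map $\Gamma_0(C):\mathcal{W}_0(\mathcal{K}_1)\to\mathcal{W}_0(\mathcal{K}_2)$; (ii) this map is strongly continuous and admits a unique strongly continuous extension $\Gamma(C):\mathcal{W}(\mathcal{K}_1)\to\mathcal{W}(\mathcal{K}_2)$; (iii) $\Gamma(C)$ is an operation from $(\mathcal{W}(\mathcal{K}_1),\varphi_1)$ to $(\mathcal{W}(\mathcal{K}_2),\varphi_2)$, i.e. it is linear, strongly continuous, completely positive, identity preserving ($\Gamma(C)(I)=I$) and state preserving ($\varphi_2\circ\Gamma(C)=\varphi_1$)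.
   Context: Inner products are conjugate-linear in the first argument. A representation of the CCR over a complex Hilbert space $\mathcal{K}$ is a map $W$ from $\mathcal{K}$ to the unitary operators on a Hilbert space $\mathcal{H}$ with $W(f)W(g)=e^{-i\,\mathrm{Im}\langle f,g\rangle}W(f+g)$ for all $f,g\in\mathcal{K}$, such that $t\mapsto W(tf)\xi$ is continuous on $\mathbb{R}$ for all $f\in\mathcal{K},\xi\in\mathcal{H}$. It is a vacuum representation if there is a unit vector $\Omega\in\mathcal{H}$ with $\langle\Omega,W(f)\Omega\rangle=e^{-\frac12\|f\|^2}$ for all $f$, and it is cyclic if moreover $\{W(f)\Omega:f\in\mathcal{K}\}$ has dense linear span in $\mathcal{H}$. A sequence $A_n$ of bounded operators converges strongly to $A$ if $A_n\xi\to A\xi$ for every vector $\xi$; a map $T$ between sets of bounded operators is strongly continuous if $A_n\to A$ strongly implies $T(A_n)\to T(A)$ strongly. A von Neumann algebra on $\mathcal{H}$ is a set of bounded operators on $\mathcal{H}$ containing the identity and closed under linear combinations, products, adjoints and strong limits; the von Neumann algebra generated by a set is the smallest one containing it. A linear map $T:\mathcal{A}\to\mathcal{B}$ is completely positive if for all $n$ the map $T\otimes \mathrm{Id}:\mathcal{A}\otimes M_n(\mathbb{C})\to\mathcal{B}\otimes M_n(\mathbb{C})$ sends positive elements to positive elements. *)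

theory Defs
  imports
    "HOL-Analysis.Analysis"
    "HOL-Library.Function_Algebras"
begin

section \<open>Complex vector spaces and complex Hilbert spaces\<close>

class complex_vector = real_vector +
  fixes scaleC :: "complex \<Rightarrow> 'a \<Rightarrow> 'a"  (infixr "*\<^sub>C" 75)
  assumes scaleC_add_right: "a *\<^sub>C (x + y) = a *\<^sub>C x + a *\<^sub>C y"
    and scaleC_add_left: "(a + b) *\<^sub>C x = a *\<^sub>C x + b *\<^sub>C x"
    and scaleC_scaleC: "a *\<^sub>C (b *\<^sub>C x) = (a * b) *\<^sub>C x"
    and scaleC_one: "1 *\<^sub>C x = x"
    and scaleR_eq_scaleC: "r *\<^sub>R x = complex_of_real r *\<^sub>C x"

global_interpretation complex_vector: vector_space "scaleC :: complex \<Rightarrow> 'a \<Rightarrow> 'a::complex_vector"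
  defines cspan = complex_vector.span
    and csubspace = complex_vector.subspace
  by unfold_locales (simp_all add: scaleC_add_right scaleC_add_left scaleC_scaleC scaleC_one)

abbreviation clinear :: "('a::complex_vector \<Rightarrow> 'b::complex_vector) \<Rightarrow> bool" where
  "clinear \<equiv> Vector_Spaces.linear scaleC scaleC"

text \<open>
  The inner product \<open>cinner\<close> is conjugate-linear in its first argument. Positivity and definiteness
  of \<open>cinner\<close>, and \<open>norm x = sqrt (Re (cinner x x))\<close>, come from the superclass \<^class>\<open>real_inner\<close>,
  whose inner product is the real part of \<open>cinner\<close>.
\<close>

class complex_inner = complex_vector + real_inner +
  fixes cinner :: "'a \<Rightarrow> 'a \<Rightarrow> complex"
  assumes cinner_commute: "cinner x y = cnj (cinner y x)"
    and cinner_add_right: "cinner x (y + z) = cinner x y + cinner x z"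
    and cinner_scaleC_right: "cinner x (a *\<^sub>C y) = a * cinner x y"
    and inner_eq_Re_cinner: "inner x y = Re (cinner x y)"

class chilbert_space = complex_inner + complete_space


section \<open>Operators\<close>

text \<open>
  Operators are functions with the pointwise vector space structure; their product is
  composition, and \<^const>\<open>id\<close> is the identity operator.
\<close>

instantiation "fun" :: (type, complex_vector) complex_vector
begin

definition scaleR_fun_def: "r *\<^sub>R f = (\<lambda>x. r *\<^sub>R f x)"
definition scaleC_fun_def: "a *\<^sub>C f = (\<lambda>x. a *\<^sub>C f x)"

instance
  by standard (simp_all add: scaleR_fun_def scaleC_fun_def fun_eq_iff algebra_simps
      scaleC_add_right scaleC_add_left scaleC_scaleC scaleC_one scaleR_eq_scaleC)

end

definition bounded_op :: "('a::complex_inner \<Rightarrow> 'b::complex_inner) \<Rightarrow> bool" where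
  "bounded_op A \<longleftrightarrow> clinear A \<and> (\<exists>K. \<forall>x. norm (A x) \<le> K * norm x)"

definition contraction :: "('a::complex_inner \<Rightarrow> 'b::complex_inner) \<Rightarrow> bool" where
  "contraction C \<longleftrightarrow> clinear C \<and> (\<forall>x. norm (C x) \<le> norm x)"

text \<open>On a Hilbert space every bounded operator has exactly one adjoint.\<close>

definition cadjoint :: "('a::chilbert_space \<Rightarrow> 'a) \<Rightarrow> 'a \<Rightarrow> 'a" where
  "cadjoint A = (THE B. \<forall>x y. cinner (B x) y = cinner x (A y))"

definition unitary_op :: "('a::chilbert_space \<Rightarrow> 'a) \<Rightarrow> bool" where
  "unitary_op U \<longleftrightarrow> bounded_op U \<and> cadjoint U \<circ> U = id \<and> U \<circ> cadjoint U = id"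


section \<open>Strong convergence and von Neumann algebras\<close>

text \<open>
  Strong convergence, and with it closedness under strong limits and strong continuity, refers
  to sequences of operators (not to nets).
\<close>

definition strongly_tendsto ::
    "(nat \<Rightarrow> 'a \<Rightarrow> 'a) \<Rightarrow> ('a::chilbert_space \<Rightarrow> 'a) \<Rightarrow> bool" where
  "strongly_tendsto X A \<longleftrightarrow> (\<forall>\<xi>. (\<lambda>n. X n \<xi>) \<longlonglongrightarrow> A \<xi>)"

definition strongly_continuous_on ::
    "('a::chilbert_space \<Rightarrow> 'a) set \<Rightarrow> (('a \<Rightarrow> 'a) \<Rightarrow> ('b::chilbert_space \<Rightarrow> 'b)) \<Rightarrow> bool" where
  "strongly_continuous_on \<A> T \<longleftrightarrow>
     (\<forall>X A. (\<forall>n. X n \<in> \<A>) \<and> A \<in> \<A> \<and> strongly_tendsto X A \<longrightarrow>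
        strongly_tendsto (\<lambda>n. T (X n)) (T A))"

definition von_neumann_algebra :: "('a::chilbert_space \<Rightarrow> 'a) set \<Rightarrow> bool" where
  "von_neumann_algebra M \<longleftrightarrow>
     (\<forall>A\<in>M. bounded_op A) \<and>
     id \<in> M \<and>
     csubspace M \<and>
     (\<forall>A\<in>M. \<forall>B\<in>M. A \<circ> B \<in> M) \<and>
     (\<forall>A\<in>M. cadjoint A \<in> M) \<and>
     (\<forall>X A. (\<forall>n. X n \<in> M) \<and> bounded_op A \<and> strongly_tendsto X A \<longrightarrow> A \<in> M)"

definition von_neumann_generated :: "('a::chilbert_space \<Rightarrow> 'a) set \<Rightarrow> ('a \<Rightarrow> 'a) set" where
  "von_neumann_generated S = \<Inter>{M. von_neumann_algebra M \<and> S \<subseteq> M}"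


section \<open>Operations\<close>

definition op_linear_on ::
    "('a::chilbert_space \<Rightarrow> 'a) set \<Rightarrow> (('a \<Rightarrow> 'a) \<Rightarrow> ('b::chilbert_space \<Rightarrow> 'b)) \<Rightarrow> bool" where
  "op_linear_on \<A> T \<longleftrightarrow>
     (\<forall>A\<in>\<A>. \<forall>B\<in>\<A>. T (A + B) = T A + T B) \<and>
     (\<forall>a. \<forall>A\<in>\<A>. T (a *\<^sub>C A) = a *\<^sub>C T A)"

text \<open>
  An element of \<open>\<A> \<otimes> M\<^sub>n(\<complex>)\<close> is a matrix \<open>(A i j)\<close>, \<open>i, j < n\<close>, with entries in \<open>\<A>\<close>, acting
  on \<open>\<H> \<otimes> \<complex>\<^sup>n\<close>, the space of \<open>n\<close>-tuples of vectors, by \<open>(A \<xi>)\<^sub>i = (\<Sum>j<n. A i j \<xi>\<^sub>j)\<close>. It is positive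
  if \<open>\<langle>\<xi>, A \<xi>\<rangle>\<close> is real and nonnegative for every \<open>n\<close>-tuple \<open>\<xi>\<close>. Under this identification
  \<open>T \<otimes> Id\<close> is the entrywise application of \<open>T\<close>.
\<close>

definition positive_op_matrix ::
    "nat \<Rightarrow> (nat \<Rightarrow> nat \<Rightarrow> 'a \<Rightarrow> 'a::chilbert_space) \<Rightarrow> bool" where
  "positive_op_matrix n A \<longleftrightarrow>
     (\<forall>\<xi>. (\<Sum>i<n. cinner (\<xi> i) (\<Sum>j<n. A i j (\<xi> j))) \<in> \<real>\<^sub>\<ge>\<^sub>0)"

definition completely_positive_on ::
    "('a::chilbert_space \<Rightarrow> 'a) set \<Rightarrow> (('a \<Rightarrow> 'a) \<Rightarrow> ('b::chilbert_space \<Rightarrow> 'b)) \<Rightarrow> bool" where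
  "completely_positive_on \<A> T \<longleftrightarrow>
     (\<forall>n A. (\<forall>i<n. \<forall>j<n. A i j \<in> \<A>) \<and> positive_op_matrix n A \<longrightarrow>
        positive_op_matrix n (\<lambda>i j. T (A i j)))"

definition operation ::
    "('a::chilbert_space \<Rightarrow> 'a) set \<Rightarrow> (('a \<Rightarrow> 'a) \<Rightarrow> complex) \<Rightarrow>
     ('b::chilbert_space \<Rightarrow> 'b) set \<Rightarrow> (('b \<Rightarrow> 'b) \<Rightarrow> complex) \<Rightarrow>
     (('a \<Rightarrow> 'a) \<Rightarrow> ('b \<Rightarrow> 'b)) \<Rightarrow> bool" where
  "operation \<A> \<phi> \<B> \<psi> T \<longleftrightarrow>
     T \<in> \<A> \<rightarrow> \<B> \<and>
     op_linear_on \<A> T \<and>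
     strongly_continuous_on \<A> T \<and>
     completely_positive_on \<A> T \<and>
     T id = id \<and>
     (\<forall>A\<in>\<A>. \<psi> (T A) = \<phi> A)"


section \<open>Representations of the CCR\<close>

definition ccr_representation ::
    "('k::chilbert_space \<Rightarrow> 'h::chilbert_space \<Rightarrow> 'h) \<Rightarrow> bool" where
  "ccr_representation W \<longleftrightarrow>
     (\<forall>f. unitary_op (W f)) \<and>
     (\<forall>f g. W f \<circ> W g = exp (- (\<i> * complex_of_real (Im (cinner f g)))) *\<^sub>C W (f + g)) \<and>
     (\<forall>f \<xi>. continuous_on UNIV (\<lambda>t::real. W (t *\<^sub>R f) \<xi>))"

definition vacuum_representation ::
    "('k::chilbert_space \<Rightarrow> 'h::chilbert_space \<Rightarrow> 'h) \<Rightarrow> 'h \<Rightarrow> bool" where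
  "vacuum_representation W \<Omega> \<longleftrightarrow>
     ccr_representation W \<and>
     norm \<Omega> = 1 \<and>
     (\<forall>f. cinner \<Omega> (W f \<Omega>) = complex_of_real (exp (- (1/2) * (norm f)\<^sup>2)))"

definition cyclic_vacuum_representation ::
    "('k::chilbert_space \<Rightarrow> 'h::chilbert_space \<Rightarrow> 'h) \<Rightarrow> 'h \<Rightarrow> bool" where
  "cyclic_vacuum_representation W \<Omega> \<longleftrightarrow>
     vacuum_representation W \<Omega> \<and>
     closure (cspan (range (\<lambda>f. W f \<Omega>))) = UNIV"

definition weyl_span :: "('k::chilbert_space \<Rightarrow> 'h::chilbert_space \<Rightarrow> 'h) \<Rightarrow> ('h \<Rightarrow> 'h) set" where
  "weyl_span W = cspan (range W)"

definition weyl_algebra :: "('k::chilbert_space \<Rightarrow> 'h::chilbert_space \<Rightarrow> 'h) \<Rightarrow> ('h \<Rightarrow> 'h) set" where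
  "weyl_algebra W = von_neumann_generated (weyl_span W)"

definition vacuum_state :: "'h::chilbert_space \<Rightarrow> ('h \<Rightarrow> 'h) \<Rightarrow> complex" where
  "vacuum_state \<Omega> A = cinner \<Omega> (A \<Omega>)"


section \<open>Second quantization of a contraction\<close>

text \<open>
  Maps between sets of operators are taken in the extensional function space \<open>\<rightarrow>\<^sub>E\<close>, so that two
  of them are equal as soon as they agree on their domain.
\<close>

definition is_Gamma0 ::
    "('k1::chilbert_space \<Rightarrow> 'h1::chilbert_space \<Rightarrow> 'h1) \<Rightarrow>
     ('k2::chilbert_space \<Rightarrow> 'h2::chilbert_space \<Rightarrow> 'h2) \<Rightarrow>
     ('k1 \<Rightarrow> 'k2) \<Rightarrow> (('h1 \<Rightarrow> 'h1) \<Rightarrow> ('h2 \<Rightarrow> 'h2)) \<Rightarrow> bool" where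
  "is_Gamma0 W1 W2 C G0 \<longleftrightarrow>
     G0 \<in> weyl_span W1 \<rightarrow>\<^sub>E weyl_span W2 \<and>
     op_linear_on (weyl_span W1) G0 \<and>
     (\<forall>f. G0 (W1 f) =
        complex_of_real (exp (- (1/2) * ((norm f)\<^sup>2 - (norm (C f))\<^sup>2))) *\<^sub>C W2 (C f))"

definition is_strongly_continuous_extension ::
    "('k1::chilbert_space \<Rightarrow> 'h1::chilbert_space \<Rightarrow> 'h1) \<Rightarrow>
     ('k2::chilbert_space \<Rightarrow> 'h2::chilbert_space \<Rightarrow> 'h2) \<Rightarrow>
     (('h1 \<Rightarrow> 'h1) \<Rightarrow> ('h2 \<Rightarrow> 'h2)) \<Rightarrow> (('h1 \<Rightarrow> 'h1) \<Rightarrow> ('h2 \<Rightarrow> 'h2)) \<Rightarrow> bool" where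
  "is_strongly_continuous_extension W1 W2 G0 G \<longleftrightarrow>
     G \<in> weyl_algebra W1 \<rightarrow>\<^sub>E weyl_algebra W2 \<and>
     strongly_continuous_on (weyl_algebra W1) G \<and>
     (\<forall>A\<in>weyl_span W1. G A = G0 A)"

end

theory Submission
  imports Defs
begin

text \<open>
  For \<open>g, h \<in> \<K>\<^sub>2\<close> let \<open>k(g, h) = exp (- (Q(g, g) + Q(h, h)) / 2 + Q(g, h))\<close> with
  \<open>Q(g, h) = \<langle>g, h\<rangle> - \<langle>C\<^sup>*g, C\<^sup>*h\<rangle>\<close>. The vacuum expectations give
  \<open>\<langle>W\<^sub>2(g)\<Omega>\<^sub>2, \<Gamma>(A) W\<^sub>2(h)\<Omega>\<^sub>2\<rangle> = k(g, h) \<langle>W\<^sub>1(C\<^sup>*g)\<Omega>\<^sub>1, A W\<^sub>1(C\<^sup>*h)\<Omega>\<^sub>1\<rangle>\<close> for \<open>A = W\<^sub>1(f)\<close>, and the right-hand side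
  makes sense for every bounded operator \<open>A\<close>. As \<open>C\<close> is a contraction, \<open>Q\<close> and hence \<open>k\<close> is positive
  semidefinite; on finite sets \<open>k\<close> is a Gram matrix, so the right-hand side behaves like
  \<open>V\<^sup>*(1 \<otimes> A)V\<close> with an isometry \<open>V\<close>. This defines \<open>\<Gamma>(A)\<close> and yields linearity, boundedness,
  complete positivity and strong continuity, and in particular \<open>\<Gamma>\<^sub>0\<close> is well defined.

  Uniqueness of the extension and \<open>\<Gamma>(\<W>(\<K>\<^sub>1)) \<subseteq> \<W>(\<K>\<^sub>2)\<close> follow once \<open>\<W>(\<K>)\<close> is known to be the closure of
  \<open>\<W>\<^sub>0(\<K>)\<close> under strong limits of sequences. The point is closedness under adjoints: if \<open>X\<^sub>n \<rightarrow> X\<close>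
  strongly, then \<open>X\<^sub>n\<^sup>* \<rightarrow> X\<^sup>*\<close> only weakly, but averages of the \<open>X\<^sub>n\<^sup>*\<close> converge strongly on any given
  countable set of vectors. Each operator in the closure commutes with \<open>W(h)\<close> for all \<open>h\<close> orthogonal to
  a countable set \<open>F\<close>, so convergence on countably many vectors \<open>W(d)\<Omega>\<close>, \<open>d\<close> in a dense subset of the
  closed span of \<open>F\<close>, suffices.
\<close>

section \<open>Complex Hilbert spaces and their bounded operators\<close>

lemma cinner_scaleC_left: "cinner (a *\<^sub>C x) y = cnj a * cinner x y"
  by (metis cinner_commute cinner_scaleC_right complex_cnj_mult)

lemma cinner_add_left: "cinner (x + y) z = cinner x z + cinner y z"
  by (metis cinner_commute cinner_add_right complex_cnj_add)

lemma scaleC_minus_one: "(- 1) *\<^sub>C x = - (x::'a::complex_vector)"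
  using scaleR_eq_scaleC [of "-1" x] by simp

lemma cinner_zero_right [simp]: "cinner x 0 = 0"
  using cinner_add_right [of x 0 0] by simp

lemma cinner_zero_left [simp]: "cinner 0 x = 0"
  using cinner_add_left [of 0 0 x] by simp

lemma cinner_minus_right: "cinner x (- y) = - cinner x y"
  using cinner_add_right [of x y "- y"] by (simp add: eq_neg_iff_add_eq_0 add.commute)

lemma cinner_minus_left: "cinner (- x) y = - cinner x y"
  using cinner_add_left [of x "- x" y] by (simp add: eq_neg_iff_add_eq_0 add.commute)

lemma cinner_diff_right: "cinner x (y - z) = cinner x y - cinner x z"
  using cinner_add_right [of x y "- z"] by (simp add: cinner_minus_right)

lemma cinner_diff_left: "cinner (x - y) z = cinner x z - cinner y z"
  using cinner_add_left [of x "- y" z] by (simp add: cinner_minus_left)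

lemma cinner_sum_right: "cinner x (\<Sum>i\<in>I. f i) = (\<Sum>i\<in>I. cinner x (f i))"
  by (induction I rule: infinite_finite_induct) (simp_all add: cinner_add_right)

lemma cinner_sum_left: "cinner (\<Sum>i\<in>I. f i) x = (\<Sum>i\<in>I. cinner (f i) x)"
  by (induction I rule: infinite_finite_induct) (simp_all add: cinner_add_left)

lemma cinner_self: "cinner x x = complex_of_real ((norm x)\<^sup>2)"
proof -
  have "Im (cinner x x) = 0"
    by (metis cinner_commute cnj.simps(2) neg_equal_zero)
  moreover have "Re (cinner x x) = (norm x)\<^sup>2"
    by (simp add: inner_eq_Re_cinner [symmetric] power2_norm_eq_inner)
  ultimately show ?thesis by (simp add: complex_eq_iff)
qed

lemma norm_scaleC: "norm (a *\<^sub>C x) = cmod a * norm (x::'a::complex_inner)"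
proof -
  have "complex_of_real ((norm (a *\<^sub>C x))\<^sup>2) = complex_of_real ((cmod a * norm x)\<^sup>2)"
    by (simp only: cinner_self [symmetric] cinner_scaleC_left cinner_scaleC_right)
      (simp add: cinner_self power_mult_distrib mult.assoc [symmetric] mult.commute
        flip: complex_norm_square)
  then have "(norm (a *\<^sub>C x))\<^sup>2 = (cmod a * norm x)\<^sup>2"
    using of_real_eq_iff by blast
  then show ?thesis
    by (simp add: power2_eq_iff_nonneg)
qed

lemma cinner_Cauchy_Schwarz: "cmod (cinner x y) \<le> norm x * norm y"
proof -
  \<comment> \<open>Multiplying y by a phase u turns the inner product into its modulus, so that the
    real Cauchy-Schwarz inequality applies.\<close>
  obtain u where u: "cmod u = 1" "u * cinner x y = complex_of_real (cmod (cinner x y))"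
  proof (cases "cinner x y = 0")
    case True then show ?thesis by (intro that [of 1]) auto
  next
    case False
    show ?thesis
    proof (rule that [of "cnj (cinner x y) / complex_of_real (cmod (cinner x y))"])
      show "cmod (cnj (cinner x y) / complex_of_real (cmod (cinner x y))) = 1"
        using False by (simp add: norm_divide)
      show "cnj (cinner x y) / complex_of_real (cmod (cinner x y)) * cinner x y
          = complex_of_real (cmod (cinner x y))"
        using False
        by (simp add: divide_simps power2_eq_square mult.commute [of "cnj _"]
            flip: complex_norm_square)
    qed
  qed
  have "cmod (cinner x y) = Re (cinner x (u *\<^sub>C y))"
    using u by (simp add: cinner_scaleC_right)
  also have "\<dots> \<le> norm x * norm (u *\<^sub>C y)"
    by (simp add: inner_eq_Re_cinner [symmetric] norm_cauchy_schwarz)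
  finally show ?thesis using u by (simp add: norm_scaleC)
qed

lemma cinner_eq_I:
  assumes "\<And>z. cinner z x = cinner z y" shows "x = y"
proof -
  have "cinner (x - y) (x - y) = 0"
    using assms by (simp add: cinner_diff_right)
  then show ?thesis by (simp add: cinner_self)
qed

lemma norm_le_cinner:
  assumes "\<And>y. cmod (cinner x y) \<le> M * norm y" and "M \<ge> 0"
  shows "norm x \<le> M"
proof (cases "x = 0")
  case False
  have "(norm x)\<^sup>2 = cmod (cinner x x)" by (simp add: cinner_self norm_power)
  also have "\<dots> \<le> M * norm x" using assms by blast
  finally show ?thesis using False by (simp add: power2_eq_square)
qed (use assms in auto)

lemma bounded_linear_cinner_right: "bounded_linear (cinner x)"
  by (rule bounded_linear_intro [of _ "norm x"])
    (simp_all add: cinner_add_right scaleR_eq_scaleC cinner_scaleC_right scaleR_conv_of_real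
      mult.commute cinner_Cauchy_Schwarz [THEN order_trans])

lemma tendsto_cinner_right: "(f \<longlongrightarrow> y) F \<Longrightarrow> ((\<lambda>n. cinner x (f n)) \<longlongrightarrow> cinner x y) F"
  by (rule bounded_linear.tendsto [OF bounded_linear_cinner_right])

lemma tendsto_cinner_left: "(f \<longlongrightarrow> y) F \<Longrightarrow> ((\<lambda>n. cinner (f n) x) \<longlongrightarrow> cinner y x) F"
  using tendsto_cnj [OF tendsto_cinner_right [of f y F x]] by (simp add: cinner_commute [symmetric])

lemma tendsto_scaleC: "(f \<longlongrightarrow> y) F \<Longrightarrow> ((\<lambda>n. a *\<^sub>C f n) \<longlongrightarrow> a *\<^sub>C (y::'a::complex_inner)) F"
  by (rule bounded_linear.tendsto [of "\<lambda>x. a *\<^sub>C x"], rule bounded_linear_intro [of _ "cmod a"])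
    (simp_all add: scaleC_add_right scaleR_eq_scaleC scaleC_scaleC norm_scaleC mult.commute)

section \<open>Riesz representation and orthogonal projection\<close>

text \<open>The representing vector minimizes the quadratic functional J: minimizing sequences in S
  are Cauchy, and stationarity of J at their limit is the desired identity. Since S is not assumed
  closed, the minimizer is only found in its closure.\<close>

theorem Riesz_csubspace:
  fixes S :: "'a::chilbert_space set" and \<phi> :: "'a \<Rightarrow> complex"
  assumes S: "csubspace S"
    and add: "\<And>x y. x \<in> S \<Longrightarrow> y \<in> S \<Longrightarrow> \<phi> (x + y) = \<phi> x + \<phi> y"
    and scale: "\<And>a x. x \<in> S \<Longrightarrow> \<phi> (a *\<^sub>C x) = a * \<phi> x"
    and bound: "\<And>x. x \<in> S \<Longrightarrow> cmod (\<phi> x) \<le> M * norm x"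
  obtains w where "w \<in> closure S" "\<And>x. x \<in> S \<Longrightarrow> \<phi> x = cinner w x"
proof -
  define J where "J y = inner y y - 2 * Re (\<phi> y)" for y
  note Sadd = complex_vector.subspace_add [OF S] and Sscale = complex_vector.subspace_scale [OF S]
  have SscaleR: "r *\<^sub>R x \<in> S" if "x \<in> S" for r x
    using Sscale that by (simp add: scaleR_eq_scaleC)
  have \<phi>R: "\<phi> (r *\<^sub>R x) = r * \<phi> x" if "x \<in> S" for r x
    using scale that by (simp add: scaleR_eq_scaleC)
  have 0: "0 \<in> S" using S by (rule complex_vector.subspace_0)
  have bdd: "J y \<ge> - (M\<^sup>2)" if "y \<in> S" for y
  proof -
    have "Re (\<phi> y) \<le> M * norm y"
      using bound [OF that] complex_Re_le_cmod order_trans by blast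
    moreover have "0 \<le> (norm y - M)\<^sup>2" by simp
    then have "2 * (M * norm y) - M\<^sup>2 \<le> inner y y"
      by (simp add: power2_diff power2_norm_eq_inner algebra_simps)
    ultimately show ?thesis by (simp add: J_def)
  qed
  define m where "m = Inf (J ` S)"
  have bb: "bdd_below (J ` S)" using bdd by (rule bdd_belowI2)
  have m_le: "m \<le> J y" if "y \<in> S" for y
    unfolding m_def using bb that by (simp add: cInf_lower)
  have "\<exists>y\<in>S. J y < m + 1 / real (Suc n)" for n
  proof -
    have "Inf (J ` S) < m + 1 / real (Suc n)" by (simp add: m_def)
    then show ?thesis using cInf_lessD [of "J ` S"] 0 by blast
  qed
  then obtain y where yS: "\<And>n. y n \<in> S" and y: "\<And>n. J (y n) < m + 1 / real (Suc n)"
    by metis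
  \<comment> \<open>The parallelogram identity, combined with the fact that J is still at least m at
    the midpoint of u and v.\<close>
  have par: "(norm (u - v))\<^sup>2 \<le> 2 * (J u - m) + 2 * (J v - m)" if "u \<in> S" "v \<in> S" for u v
  proof -
    have "m \<le> J ((1/2) *\<^sub>R (u + v))" using that by (intro m_le SscaleR Sadd)
    also have "\<dots> = (1/4) * inner (u + v) (u + v) - Re (\<phi> u + \<phi> v)"
      using that by (simp add: J_def \<phi>R Sadd add add_divide_distrib)
    finally show ?thesis
      by (simp add: J_def power2_norm_eq_inner inner_add_left inner_add_right inner_diff_left
          inner_diff_right inner_commute field_simps)
  qed
  have "Cauchy y"
  proof (rule metric_CauchyI)
    fix e :: real assume "e > 0"
    then have "e\<^sup>2 / 4 > 0" by simp
    then obtain N where N: "1 / real (Suc N) < e\<^sup>2 / 4"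
      using nat_approx_posE by blast
    have J_less: "J (y i) < m + e\<^sup>2 / 4" if "i \<ge> N" for i
    proof -
      have "1 / real (Suc i) \<le> 1 / real (Suc N)" using that by (simp add: frac_le)
      then have "m + 1 / real (Suc i) \<le> m + e\<^sup>2 / 4" using N by simp
      with y [of i] show ?thesis by (rule less_le_trans)
    qed
    have "dist (y i) (y j) < e" if "i \<ge> N" "j \<ge> N" for i j
    proof -
      have "(norm (y i - y j))\<^sup>2 < e\<^sup>2"
        using par [OF yS yS, of i j] J_less [OF that(1)] J_less [OF that(2)] by simp
      then show ?thesis using \<open>e > 0\<close> by (simp add: dist_norm power2_less_imp_less)
    qed
    then show "\<exists>M. \<forall>m\<ge>M. \<forall>n\<ge>M. dist (y m) (y n) < e" by blast
  qed
  then obtain w where w: "y \<longlonglongrightarrow> w"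
    using Cauchy_convergent convergent_def by blast
  have "w \<in> closure S"
    using w yS closure_sequential by blast
  \<comment> \<open>Minimality is applied near the \<open>y n\<close> and passed to the limit,
    because w may lie outside S, where nothing is known about \<phi>.\<close>
  have quad: "2 * t * (inner w x - Re (\<phi> x)) + t\<^sup>2 * inner x x \<ge> 0" if x: "x \<in> S" for t x
  proof -
    have "2 * t * (inner (y n) x - Re (\<phi> x)) + t\<^sup>2 * inner x x \<ge> - (1 / real (Suc n))" for n
    proof -
      have "m \<le> J (y n + t *\<^sub>R x)" by (intro m_le SscaleR Sadd yS x)
      also have "\<dots> = J (y n) + 2 * t * (inner (y n) x - Re (\<phi> x)) + t\<^sup>2 * inner x x"
        using yS [of n] x
        by (simp add: J_def add SscaleR \<phi>R inner_add_left inner_add_right inner_commute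
            algebra_simps power2_eq_square)
      finally show ?thesis using y [of n] by linarith
    qed
    moreover have "(\<lambda>n. 2 * t * (inner (y n) x - Re (\<phi> x)) + t\<^sup>2 * inner x x)
        \<longlonglongrightarrow> 2 * t * (inner w x - Re (\<phi> x)) + t\<^sup>2 * inner x x"
      by (intro tendsto_intros w)
    moreover have "(\<lambda>n. - (1 / real (Suc n))) \<longlonglongrightarrow> - 0"
      by (intro tendsto_minus LIMSEQ_Suc lim_1_over_n)
    ultimately show ?thesis
      by (metis (no_types, lifting) LIMSEQ_le minus_zero)
  qed
  have re: "inner w x = Re (\<phi> x)" if x: "x \<in> S" for x
  proof -
    define d where "d = inner w x - Re (\<phi> x)"
    define s where "s = inner x x + 1"
    have s: "s \<ge> 1" by (simp add: s_def)
    \<comment> \<open>A nearly optimal t; with s in place of \<open>inner x x\<close> no division by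
      zero occurs, and the value is still negative unless d = 0.\<close>
    have "2 * (- d / s) * d + (- d / s)\<^sup>2 * (s - 1) \<ge> 0"
      using quad [OF x, of "- d / s"] by (simp add: d_def s_def)
    also have "2 * (- d / s) * d + (- d / s)\<^sup>2 * (s - 1) = - (d\<^sup>2) * (s + 1) / s\<^sup>2"
      using s by (simp add: field_simps power2_eq_square)
    finally have "d\<^sup>2 * (s + 1) \<le> 0"
      using s zero_less_power [of s 2] by (simp add: divide_le_0_iff)
    then have "d = 0" using s by (simp add: mult_le_0_iff)
    then show ?thesis by (simp add: d_def)
  qed
  have "\<phi> x = cinner w x" if x: "x \<in> S" for x
  proof (rule complex_eqI)
    show "Re (\<phi> x) = Re (cinner w x)" using re [OF x] by (simp add: inner_eq_Re_cinner)
    \<comment> \<open>The identity of real parts at \<open>\<i> *\<^sub>C x\<close> yields the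
      imaginary parts at x.\<close>
    have "Re (cinner w (\<i> *\<^sub>C x)) = Re (\<phi> (\<i> *\<^sub>C x))"
      using re [OF Sscale [OF x]] by (simp add: inner_eq_Re_cinner)
    then show "Im (\<phi> x) = Im (cinner w x)"
      by (simp add: scale [OF x] cinner_scaleC_right)
  qed
  with \<open>w \<in> closure S\<close> show ?thesis by (rule that)
qed

text \<open>The vector representing the functional \<open>cinner x\<close> on S is the projection of
  x onto S.\<close>

corollary orthogonal_decomposition:
  fixes S :: "'a::chilbert_space set"
  assumes "csubspace S" "closed S"
  obtains y z where "x = y + z" "y \<in> S" "\<And>s. s \<in> S \<Longrightarrow> cinner s z = 0"
proof -
  obtain w where w: "w \<in> closure S" "\<And>s. s \<in> S \<Longrightarrow> cinner x s = cinner w s"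
    using assms(1)
    by (rule Riesz_csubspace [where \<phi> = "cinner x" and M = "norm x"])
      (auto simp: cinner_add_right cinner_scaleC_right cinner_Cauchy_Schwarz)
  show ?thesis
  proof (rule that [of w "x - w"])
    show "w \<in> S" using w assms(2) by simp
    show "cinner s (x - w) = 0" if "s \<in> S" for s
      using w(2) [OF that] by (metis cinner_commute cinner_diff_right right_minus_eq)
  qed simp
qed

section \<open>Bounded operators and their adjoints\<close>

lemma bounded_op_iff:
  "bounded_op A \<longleftrightarrow> (\<forall>x y. A (x + y) = A x + A y) \<and> (\<forall>a x. A (a *\<^sub>C x) = a *\<^sub>C A x)
     \<and> (\<exists>K\<ge>0. \<forall>x. norm (A x) \<le> K * norm x)"
proof -
  have "(\<exists>K. \<forall>x. norm (A x) \<le> K * norm x) \<longleftrightarrow> (\<exists>K\<ge>0. \<forall>x. norm (A x) \<le> K * norm x)"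
    by (metis abs_ge_self abs_ge_zero mult_right_mono norm_ge_zero order_trans)
  then show ?thesis
    by (auto simp: bounded_op_def Vector_Spaces.linear_iff complex_vector.vector_space_axioms)
qed

lemma bounded_opI:
  assumes "\<And>x y. A (x + y) = A x + A y" "\<And>a x. A (a *\<^sub>C x) = a *\<^sub>C A x"
    "\<And>x. norm (A x) \<le> K * norm x"
  shows "bounded_op A"
  using assms by (auto simp: bounded_op_def Vector_Spaces.linear_iff complex_vector.vector_space_axioms)

lemma bounded_op_add: "bounded_op A \<Longrightarrow> A (x + y) = A x + A y"
  and bounded_op_scaleC: "bounded_op A \<Longrightarrow> A (a *\<^sub>C x) = a *\<^sub>C A x"
  by (simp_all add: bounded_op_iff)

lemma bounded_op_bound:
  assumes "bounded_op A" obtains K where "K \<ge> 0" "\<And>x. norm (A x) \<le> K * norm x"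
  using assms by (auto simp: bounded_op_iff)

lemma bounded_op_bounded_linear: "bounded_op A \<Longrightarrow> bounded_linear A"
  unfolding bounded_op_iff bounded_linear_def bounded_linear_axioms_def linear_iff
  by (auto simp: scaleR_eq_scaleC mult.commute)

lemma bounded_op_diff: "bounded_op A \<Longrightarrow> A (x - y) = A x - A y"
  by (simp add: bounded_op_bounded_linear bounded_linear.linear linear_diff)

lemma bounded_op_sum: "bounded_op A \<Longrightarrow> A (\<Sum>i\<in>I. f i) = (\<Sum>i\<in>I. A (f i))"
  by (simp add: bounded_op_bounded_linear bounded_linear.linear linear_sum)

lemma bounded_op_tendsto: "bounded_op A \<Longrightarrow> (f \<longlongrightarrow> x) F \<Longrightarrow> ((\<lambda>n. A (f n)) \<longlongrightarrow> A x) F"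
  by (rule bounded_linear.tendsto [OF bounded_op_bounded_linear])

lemma bounded_op_plus: "bounded_op A \<Longrightarrow> bounded_op B \<Longrightarrow> bounded_op (A + B)"
proof -
  assume A: "bounded_op A" and B: "bounded_op B"
  obtain K L where K: "\<And>x. norm (A x) \<le> K * norm x" and L: "\<And>x. norm (B x) \<le> L * norm x"
    using A B by (metis bounded_op_bound)
  show ?thesis
  proof (rule bounded_opI)
    show "norm ((A + B) x) \<le> (K + L) * norm x" for x
      using K [of x] L [of x] norm_triangle_ineq [of "A x" "B x"]
      by (simp add: distrib_right)
  qed (simp_all add: A B bounded_op_add bounded_op_scaleC scaleC_add_right)
qed

lemma bounded_op_scale: "bounded_op A \<Longrightarrow> bounded_op (a *\<^sub>C A)"
proof -
  assume A: "bounded_op A"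
  obtain K where K: "\<And>x. norm (A x) \<le> K * norm x"
    using A by (metis bounded_op_bound)
  show ?thesis
  proof (rule bounded_opI)
    show "norm ((a *\<^sub>C A) x) \<le> (cmod a * K) * norm x" for x
      using K [of x] by (simp add: scaleC_fun_def norm_scaleC mult.assoc mult_left_mono)
  qed (simp_all add: A bounded_op_add bounded_op_scaleC scaleC_add_right scaleC_fun_def
      scaleC_scaleC mult.commute)
qed

lemma bounded_op_comp: "bounded_op A \<Longrightarrow> bounded_op B \<Longrightarrow> bounded_op (A \<circ> B)"
proof -
  assume A: "bounded_op A" and B: "bounded_op B"
  obtain K L where K: "K \<ge> 0" "\<And>x. norm (A x) \<le> K * norm x" and L: "\<And>x. norm (B x) \<le> L * norm x"
    using A B by (metis bounded_op_bound)
  show ?thesis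
  proof (rule bounded_opI)
    show "norm ((A \<circ> B) x) \<le> (K * L) * norm x" for x
      using K(2) [of "B x"] mult_left_mono [OF L [of x] K(1)] by (simp add: mult.assoc)
  qed (simp_all add: A B bounded_op_add bounded_op_scaleC)
qed

lemma bounded_op_id: "bounded_op id"
  by (rule bounded_opI [of _ 1]) simp_all

lemma bounded_op_zero: "bounded_op 0"
  by (rule bounded_opI [of _ 0]) simp_all

lemma csubspace_bounded_op: "csubspace {A. bounded_op A}"
  by (simp add: complex_vector.subspace_def bounded_op_zero bounded_op_plus bounded_op_scale)

text \<open>Riesz at each fixed x gives \<open>B x\<close>; as this vector is determined by its
  inner products, B inherits linearity from F. The constant M is kept so that adjoints inherit
  bounds.\<close>

lemma bounded_op_of_sesquilinear:
  fixes F :: "'b::chilbert_space \<Rightarrow> 'a::chilbert_space \<Rightarrow> complex"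
  assumes "\<And>x y z. F x (y + z) = F x y + F x z" "\<And>x a y. F x (a *\<^sub>C y) = a * F x y"
    and "\<And>x y z. F (x + y) z = F x z + F y z" "\<And>x a y. F (a *\<^sub>C x) y = cnj a * F x y"
    and "\<And>x y. cmod (F x y) \<le> M * norm x * norm y" and "M \<ge> 0"
  obtains B where "bounded_op B" "\<And>x y. cinner (B x) y = F x y" "\<And>x. norm (B x) \<le> M * norm x"
proof -
  have "\<exists>w. \<forall>y. F x y = cinner w y" for x
    by (rule Riesz_csubspace [of UNIV "F x" "M * norm x"]) (use assms in auto)
  then obtain B where B: "\<And>x y. cinner (B x) y = F x y" by metis
  have bound: "norm (B x) \<le> M * norm x" for x
    using assms by (intro norm_le_cinner) (simp_all add: B)
  have ext: "B x = z" if "\<And>y. cinner z y = F x y" for x z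
    by (rule cinner_eq_I) (metis that B cinner_commute)
  show ?thesis
  proof (rule that)
    show "bounded_op B"
      using bound by (intro bounded_opI)
        (auto intro!: ext simp: assms B cinner_add_left cinner_scaleC_left)
  qed (use B bound in auto)
qed

lemma adjoint_exists:
  fixes A :: "'a::chilbert_space \<Rightarrow> 'b::chilbert_space"
  assumes A: "bounded_op A" and K: "K \<ge> 0" "\<And>x. norm (A x) \<le> K * norm x"
  obtains B where "bounded_op B" "\<And>x y. cinner (B x) y = cinner x (A y)"
    "\<And>x. norm (B x) \<le> K * norm x"
proof (rule bounded_op_of_sesquilinear [where F = "\<lambda>x y. cinner x (A y)" and M = K])
  show "cmod (cinner x (A y)) \<le> K * norm x * norm y" for x y
    using cinner_Cauchy_Schwarz [of x "A y"] mult_left_mono [OF K(2) [of y] norm_ge_zero [of x]]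
    by (simp add: mult_ac)
qed (use K in \<open>simp_all add: A bounded_op_add bounded_op_scaleC cinner_add_right cinner_add_left
    cinner_scaleC_right cinner_scaleC_left\<close>)

text \<open>The tool for evaluating the \<open>THE\<close> in \<open>cadjoint\<close>: it suffices
  to exhibit a map with the adjoint relation.\<close>

lemma cadjoint_unique:
  assumes "\<And>x y. cinner (B x) y = cinner x (A y)"
  shows "cadjoint A = B"
  unfolding cadjoint_def
proof (rule the_equality)
  show "B' = B" if "\<forall>x y. cinner (B' x) y = cinner x (A y)" for B'
    by (rule ext, rule cinner_eq_I) (metis that assms cinner_commute)
qed (use assms in blast)

lemma bounded_op_cadjoint: "bounded_op A \<Longrightarrow> bounded_op (cadjoint A)"
  and cinner_cadjoint_left: "bounded_op A \<Longrightarrow> cinner (cadjoint A x) y = cinner x (A y)"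
proof -
  assume A: "bounded_op A"
  obtain K where "K \<ge> 0" "\<And>x. norm (A x) \<le> K * norm x" by (metis bounded_op_bound A)
  then obtain B where B: "bounded_op B" "\<And>x y. cinner (B x) y = cinner x (A y)"
    by (metis A adjoint_exists)
  then show "bounded_op (cadjoint A)" "cinner (cadjoint A x) y = cinner x (A y)"
    using cadjoint_unique [of B A] by auto
qed

lemma cinner_cadjoint_right: "bounded_op A \<Longrightarrow> cinner x (cadjoint A y) = cinner (A x) y"
  by (metis cinner_cadjoint_left cinner_commute)

lemma norm_cadjoint_le:
  assumes "bounded_op A" "K \<ge> 0" "\<And>x. norm (A x) \<le> K * norm x"
  shows "norm (cadjoint A x) \<le> K * norm x"
  using adjoint_exists [OF assms] cadjoint_unique by metis

lemma cadjoint_cadjoint: "bounded_op A \<Longrightarrow> cadjoint (cadjoint A) = A"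
  by (rule cadjoint_unique) (simp add: cinner_cadjoint_right)

lemma cadjoint_plus: "bounded_op A \<Longrightarrow> bounded_op B \<Longrightarrow> cadjoint (A + B) = cadjoint A + cadjoint B"
  by (rule cadjoint_unique) (simp add: cinner_cadjoint_left cinner_add_left cinner_add_right)

lemma cadjoint_scaleC: "bounded_op A \<Longrightarrow> cadjoint (a *\<^sub>C A) = cnj a *\<^sub>C cadjoint A"
  by (rule cadjoint_unique)
    (simp add: cinner_cadjoint_left cinner_scaleC_left cinner_scaleC_right scaleC_fun_def)

lemma cadjoint_comp: "bounded_op A \<Longrightarrow> bounded_op B \<Longrightarrow> cadjoint (A \<circ> B) = cadjoint B \<circ> cadjoint A"
  by (rule cadjoint_unique) (simp add: cinner_cadjoint_left)

text \<open>Banach-Steinhaus by Baire category: the closed sets \<open>F k\<close> cover the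
  complete space, so one of them contains a ball, and a bound on a ball around a gives one on a ball
  around 0.\<close>

lemma uniform_boundedness:
  fixes X :: "nat \<Rightarrow> 'a::chilbert_space \<Rightarrow> 'b::complex_inner"
  assumes X: "\<And>n. bounded_op (X n)" and bdd: "\<And>x. \<exists>B. \<forall>n. norm (X n x) \<le> B"
  obtains M where "M \<ge> 0" "\<And>n x. norm (X n x) \<le> M * norm x"
proof -
  define F where "F k = {x. \<forall>n. norm (X n x) \<le> real k}" for k
  have cont: "continuous_on UNIV (X n)" for n
    using bounded_op_bounded_linear [OF X] by (simp add: linear_continuous_on)
  have clF: "closed (F k)" for k
    unfolding F_def by (intro closed_Collect_all closed_Collect_le continuous_intros cont)
  have "(\<Union>k. F k) = UNIV"
  proof (intro set_eqI iffI UNIV_I)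
    fix x
    obtain B where "\<forall>n. norm (X n x) \<le> B" using bdd by blast
    moreover obtain k where "B \<le> real k" using real_arch_simple by blast
    ultimately have "x \<in> F k" unfolding F_def by (auto intro: order_trans)
    then show "x \<in> (\<Union>k. F k)" by blast
  qed
  have "\<exists>k. interior (F k) \<noteq> {}"
  proof (rule ccontr)
    assume "\<not> ?thesis"
    then have "(euclidean::'a topology) interior_of \<Union>(range F) = {}"
      using clF
      by (intro Baire_category_alt disjI1)
        (auto simp: closed_closedin [symmetric] Met_TC.completely_metrizable_space_mtopology
          complete_UNIV completely_metrizable_space_euclidean)
    then show False using \<open>(\<Union>k. F k) = UNIV\<close> by simp
  qed
  then obtain k a r where r: "r > 0" "ball a r \<subseteq> F k"
    by (metis ex_in_conv mem_interior)
  have le: "norm (X n x) \<le> (4 * real k / r) * norm x" for n x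
  proof (cases "x = 0")
    case True then show ?thesis using bounded_op_diff [OF X, of n 0 0] by simp
  next
    case False
    \<comment> \<open>This scales x to half the radius, so that \<open>a + t *\<^sub>R x\<close>
      stays inside the ball.\<close>
    define t where "t = r / (2 * norm x)"
    have t: "t > 0" using False r by (simp add: t_def)
    have "norm (t *\<^sub>R x) < r" using False r by (simp add: t_def)
    then have "a + t *\<^sub>R x \<in> F k" "a \<in> F k" using r by (auto simp: dist_norm subset_iff)
    then have "norm (X n (a + t *\<^sub>R x) - X n a) \<le> real k + real k"
      unfolding F_def by (intro norm_triangle_le_diff add_mono) auto
    also have "X n (a + t *\<^sub>R x) - X n a = t *\<^sub>R X n x"
      by (simp add: bounded_op_add [OF X] scaleR_eq_scaleC bounded_op_scaleC [OF X])
    finally have "t * norm (X n x) \<le> 2 * real k" using t by simp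
    then show ?thesis using False r by (simp add: t_def field_simps)
  qed
  show ?thesis by (rule that [OF _ le]) (use r in simp)
qed

section \<open>Strong sequential closure\<close>

lemma csubspace_closure:
  fixes S :: "'a::complex_inner set"
  assumes S: "csubspace S" shows "csubspace (closure S)"
  unfolding complex_vector.subspace_def
proof (intro conjI ballI allI)
  show "0 \<in> closure S"
    using complex_vector.subspace_0 [OF S] closure_subset by blast
  fix x assume "x \<in> closure S"
  then obtain u where u: "\<And>n. u n \<in> S" "u \<longlonglongrightarrow> x" by (auto simp: closure_sequential)
  show "a *\<^sub>C x \<in> closure S" for a
    unfolding closure_sequential
    by (rule exI [of _ "\<lambda>n. a *\<^sub>C u n"])
      (auto intro: u tendsto_scaleC complex_vector.subspace_scale [OF S])
  fix y assume "y \<in> closure S"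
  then obtain v where v: "\<And>n. v n \<in> S" "v \<longlonglongrightarrow> y" by (auto simp: closure_sequential)
  show "x + y \<in> closure S"
    unfolding closure_sequential
    by (rule exI [of _ "\<lambda>n. u n + v n"])
      (auto intro: u v tendsto_add complex_vector.subspace_add [OF S])
qed

lemma continuous_on_cinner_left: "continuous_on S (\<lambda>z. cinner z x)"
  by (simp add: continuous_on_def tendsto_cinner_left)

lemma continuous_on_bounded_op: "bounded_op A \<Longrightarrow> continuous_on S A"
  by (simp add: bounded_op_bounded_linear linear_continuous_on)

text \<open>Used mainly with the coherent vectors \<open>W f \<Omega>\<close> as S, both to identify
  vectors and operators and to prove pointwise convergence.\<close>

lemma total_induct:
  fixes S :: "'a::complex_inner set"
  assumes "closure (cspan S) = UNIV" "\<And>s. s \<in> S \<Longrightarrow> P s" "csubspace {x. P x}" "closed {x. P x}"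
  shows "P x"
proof -
  have "cspan S \<subseteq> {x. P x}" using assms by (intro complex_vector.span_minimal) auto
  then have "closure (cspan S) \<subseteq> {x. P x}" using assms by (intro closure_minimal)
  then show ?thesis using assms by auto
qed

lemma cinner_total_eq_I:
  fixes S :: "'a::complex_inner set"
  assumes S: "closure (cspan S) = UNIV" and eq: "\<And>s. s \<in> S \<Longrightarrow> cinner s x = cinner s y"
  shows "x = y"
proof (rule cinner_eq_I, rule total_induct [OF S, where P = "\<lambda>z. cinner z x = cinner z y"])
  show "csubspace {z. cinner z x = cinner z y}"
    by (simp add: complex_vector.subspace_def cinner_add_left cinner_scaleC_left)
  show "closed {z. cinner z x = cinner z y}"
    by (intro closed_Collect_eq continuous_on_cinner_left)
qed (rule eq)

lemma bounded_op_total_eq_I: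
  assumes S: "closure (cspan S) = UNIV" and A: "bounded_op A" and B: "bounded_op B"
    and eq: "\<And>s. s \<in> S \<Longrightarrow> A s = B s"
  shows "A = B"
proof (rule ext, rule total_induct [OF S, where P = "\<lambda>x. A x = B x"])
  show "csubspace {x. A x = B x}"
    using A B bounded_op_diff [OF A, of 0 0] bounded_op_diff [OF B, of 0 0]
    by (simp add: complex_vector.subspace_def bounded_op_add bounded_op_scaleC)
  show "closed {x. A x = B x}"
    by (intro closed_Collect_eq continuous_on_bounded_op A B)
qed (rule eq)

lemma csubspace_convergence:
  assumes X: "\<And>n. bounded_op (X n)" and A: "bounded_op A"
  shows "csubspace {x. (\<lambda>n. X n x) \<longlonglongrightarrow> A x}"
  using A X bounded_op_diff [OF A, of 0 0] bounded_op_diff [OF X, of _ 0 0]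
  by (auto simp: complex_vector.subspace_def bounded_op_add bounded_op_scaleC tendsto_add tendsto_scaleC)

text \<open>Thanks to the uniform bound, replacing x by a nearby point y of convergence changes
  \<open>X n x\<close> and \<open>A x\<close> only a little, uniformly in n.\<close>

lemma closed_convergence:
  fixes X :: "nat \<Rightarrow> 'a::complex_inner \<Rightarrow> 'b::complex_inner"
  assumes X: "\<And>n. bounded_op (X n)" and M: "M \<ge> 0" "\<And>n x. norm (X n x) \<le> M * norm x"
    and A: "bounded_op A"
  shows "closed {x. (\<lambda>n. X n x) \<longlonglongrightarrow> A x}"
proof -
  obtain K where K: "K \<ge> 0" "\<And>x. norm (A x) \<le> K * norm x" using A by (metis bounded_op_bound)
  have "x \<in> {x. (\<lambda>n. X n x) \<longlonglongrightarrow> A x}" if x: "x \<in> closure {x. (\<lambda>n. X n x) \<longlonglongrightarrow> A x}" for x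
  proof (simp add: tendsto_iff, intro allI impI)
    fix e :: real assume e: "e > 0"
    \<comment> \<open>The two replacement errors then cost at most e / 2 together; the summand 1
      keeps the denominator positive.\<close>
    define d where "d = e / (2 * (M + K + 1))"
    have d: "d > 0" using e M K by (simp add: d_def)
    then obtain y where y: "(\<lambda>n. X n y) \<longlonglongrightarrow> A y" "dist y x < d"
      using x by (auto simp: closure_approachable)
    have "\<forall>\<^sub>F n in sequentially. dist (X n y) (A y) < e / 2"
      using tendstoD [OF y(1), of "e / 2"] e by simp
    then show "\<forall>\<^sub>F n in sequentially. dist (X n x) (A x) < e"
    proof eventually_elim
      case (elim n)
      have "norm (X n (x - y)) \<le> M * d" "norm (A (x - y)) \<le> K * d"
        using M(2) [of n "x - y"] K(2) [of "x - y"] y(2) M(1) K(1)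
        by (auto simp: dist_norm norm_minus_commute intro: order_trans mult_left_mono less_imp_le)
      moreover have "X n x - A x = X n (x - y) + (X n y - A y) - A (x - y)"
        by (simp add: bounded_op_diff [OF X] bounded_op_diff [OF A])
      moreover have "M * d + K * d \<le> e / 2"
      proof -
        have "M * d + K * d \<le> (M + K + 1) * d" using d by (simp add: algebra_simps)
        also have "\<dots> = e / 2" using M K by (simp add: d_def field_simps)
        finally show ?thesis .
      qed
      ultimately show ?case
        using elim norm_triangle_ineq4 [of "X n (x - y) + (X n y - A y)" "A (x - y)"]
          norm_triangle_ineq [of "X n (x - y)" "X n y - A y"]
        by (simp add: dist_norm)
    qed
  qed
  then show ?thesis
    unfolding closure_subset_eq [symmetric] by (rule subsetI)
qed

section \<open>Strong convergence and iterated strong limits\<close>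

text \<open>Convergent sequences are bounded at every vector, so Banach-Steinhaus applies; this is
  one place where sequences rather than nets matter.\<close>

lemma strongly_tendsto_bound:
  assumes "\<And>n. bounded_op (X n)" "strongly_tendsto X A"
  obtains M where "M \<ge> 0" "\<And>n x. norm (X n x) \<le> M * norm x"
proof (rule uniform_boundedness [of X])
  show "\<exists>B. \<forall>n. norm (X n x) \<le> B" for x
  proof -
    have "convergent (\<lambda>n. X n x)"
      using assms(2) unfolding strongly_tendsto_def convergent_def by blast
    then show ?thesis by (metis BseqE convergent_imp_Bseq)
  qed
qed (use assms in auto)

lemma strongly_tendsto_add:
  "strongly_tendsto X A \<Longrightarrow> strongly_tendsto Y B \<Longrightarrow> strongly_tendsto (\<lambda>n. X n + Y n) (A + B)"
  by (simp add: strongly_tendsto_def tendsto_add)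

lemma strongly_tendsto_scaleC:
  "strongly_tendsto X A \<Longrightarrow> strongly_tendsto (\<lambda>n. a *\<^sub>C X n) (a *\<^sub>C A)"
  by (simp add: strongly_tendsto_def scaleC_fun_def tendsto_scaleC)

lemma strongly_tendsto_comp_right: "strongly_tendsto X A \<Longrightarrow> strongly_tendsto (\<lambda>n. X n \<circ> B) (A \<circ> B)"
  by (simp add: strongly_tendsto_def)

lemma strongly_tendsto_comp_left:
  "strongly_tendsto X A \<Longrightarrow> bounded_op B \<Longrightarrow> strongly_tendsto (\<lambda>n. B \<circ> X n) (B \<circ> A)"
  by (auto simp: strongly_tendsto_def intro: bounded_op_tendsto)

lemma strongly_tendsto_const: "strongly_tendsto (\<lambda>n. A) A"
  by (simp add: strongly_tendsto_def)

text \<open>One round of sequential limits need not give a set closed under such limits, so limits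
  of limits are generated inductively. Boundedness of the limit mirrors the condition in
  \<open>von_neumann_algebra\<close>.\<close>

inductive_set strong_closure :: "('a::chilbert_space \<Rightarrow> 'a) set \<Rightarrow> ('a \<Rightarrow> 'a) set"
  for S where
  base: "A \<in> S \<Longrightarrow> A \<in> strong_closure S"
| limit: "(\<forall>n. X n \<in> strong_closure S) \<Longrightarrow> bounded_op A \<Longrightarrow> strongly_tendsto X A
    \<Longrightarrow> A \<in> strong_closure S"

lemma strong_closure_induct [consumes 1, case_names base limit]:
  assumes "A \<in> strong_closure S" "\<And>A. A \<in> S \<Longrightarrow> P A"
    and "\<And>X A. (\<And>n. X n \<in> strong_closure S) \<Longrightarrow> (\<And>n. P (X n)) \<Longrightarrow> bounded_op A
      \<Longrightarrow> strongly_tendsto X A \<Longrightarrow> P A"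
  shows "P A"
  using assms(1) by (induct rule: strong_closure.induct) (use assms(2,3) in blast)+

lemma strong_closure_bounded_op:
  assumes "\<And>A. A \<in> S \<Longrightarrow> bounded_op A" "A \<in> strong_closure S" shows "bounded_op A"
  using assms(2) by (induction rule: strong_closure_induct) (use assms(1) in auto)

context
  fixes S :: "('a::chilbert_space \<Rightarrow> 'a) set"
  assumes S: "csubspace S" and bdd: "\<And>A. A \<in> S \<Longrightarrow> bounded_op A"
begin

text \<open>Closure under sums takes two inductions, one per summand; in this first one A still lies
  in S.\<close>

private lemma add_base: "B \<in> strong_closure S \<Longrightarrow> A \<in> S \<Longrightarrow> A + B \<in> strong_closure S"
proof (induction rule: strong_closure_induct)
  case (base B) then show ?case
    by (intro strong_closure.base complex_vector.subspace_add [OF S])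
next
  case (limit X B)
  then show ?case
    by (intro strong_closure.limit [of "\<lambda>n. A + X n"])
      (blast intro: bounded_op_plus bdd strongly_tendsto_add [OF strongly_tendsto_const])+
qed

private lemma add_closure:
  "A \<in> strong_closure S \<Longrightarrow> B \<in> strong_closure S \<Longrightarrow> A + B \<in> strong_closure S"
proof (induction rule: strong_closure_induct)
  case (base B) then show ?case by (rule add_base [rotated])
next
  case (limit X A)
  then show ?case
    by (intro strong_closure.limit [of "\<lambda>n. X n + B"])
      (blast intro: bounded_op_plus bdd strong_closure_bounded_op
        strongly_tendsto_add [OF _ strongly_tendsto_const])+
qed

lemma csubspace_strong_closure: "csubspace (strong_closure S)"
proof -
  have "a *\<^sub>C A \<in> strong_closure S" if "A \<in> strong_closure S" for a A
    using that
  proof (induction rule: strong_closure_induct)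
    case (base B) then show ?case
      by (intro strong_closure.base complex_vector.subspace_scale [OF S])
  next
    case (limit X B)
    then show ?case
      by (intro strong_closure.limit [of "\<lambda>n. a *\<^sub>C X n"])
        (blast intro: bounded_op_scale strongly_tendsto_scaleC)+
  qed
  then show ?thesis
    using complex_vector.subspace_0 [OF S] add_closure
    by (auto simp: complex_vector.subspace_def strong_closure.base)
qed

text \<open>Multiplication is strongly continuous in each factor while the other is a fixed bounded
  operator, so one induction per factor suffices.\<close>

lemma strong_closure_comp:
  assumes comp: "\<And>A B. A \<in> S \<Longrightarrow> B \<in> S \<Longrightarrow> A \<circ> B \<in> S"
    and A: "A \<in> strong_closure S" and B: "B \<in> strong_closure S"
  shows "A \<circ> B \<in> strong_closure S"
proof -
  have step: "A \<circ> B \<in> strong_closure S" if "A \<in> S" for A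
    using B
  proof (induction rule: strong_closure_induct)
    case (base B) then show ?case by (intro strong_closure.base comp that)
  next
    case (limit X B)
    then show ?case
      by (intro strong_closure.limit [of "\<lambda>n. A \<circ> X n"])
        (blast intro: bounded_op_comp bdd that strongly_tendsto_comp_left)+
  qed
  show ?thesis
    using A
  proof (induction rule: strong_closure_induct)
    case (base A) then show ?case by (rule step)
  next
    case (limit X A)
    then show ?case
      by (intro strong_closure.limit [of "\<lambda>n. X n \<circ> B"])
        (blast intro: bounded_op_comp strong_closure_bounded_op [OF bdd] B strongly_tendsto_comp_right)+
  qed
qed

end

section \<open>Averages of weakly convergent operators\<close>

text \<open>The Banach-Saks argument: each new index is taken so far out that its term is almost
  orthogonal to the sum built so far, hence squared norms grow only linearly in p. Finiteness of E
  allows one choice of indices for all its vectors.\<close>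

lemma small_sums_of_weakly_null:
  fixes Z :: "nat \<Rightarrow> 'a::chilbert_space \<Rightarrow> 'a"
  assumes weak: "\<And>x y. (\<lambda>n. cinner y (Z n x)) \<longlonglongrightarrow> 0"
    and bound: "\<And>n x. norm (Z n x) \<le> M * norm x" and "finite E"
  shows "\<exists>s::nat \<Rightarrow> nat. \<forall>x\<in>E. (norm (\<Sum>j<p. Z (s j) x))\<^sup>2 \<le> real p * (1 + (M * norm x)\<^sup>2)"
proof (induction p)
  case (Suc p)
  then obtain s where s: "\<And>x. x \<in> E \<Longrightarrow> (norm (\<Sum>j<p. Z (s j) x))\<^sup>2 \<le> real p * (1 + (M * norm x)\<^sup>2)"
    by blast
  \<comment> \<open>With inner products below 1/2 the cross term adds at most 1 to the squared
    norm.\<close>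
  have "\<forall>x\<in>E. \<forall>\<^sub>F n in sequentially. dist (cinner (\<Sum>j<p. Z (s j) x) (Z n x)) 0 < 1/2"
    using tendstoD [OF weak, of "1/2"] by simp
  then have "\<forall>\<^sub>F n in sequentially. \<forall>x\<in>E. dist (cinner (\<Sum>j<p. Z (s j) x) (Z n x)) 0 < 1/2"
    using \<open>finite E\<close> by (simp add: eventually_ball_finite)
  then obtain n where n: "\<And>x. x \<in> E \<Longrightarrow> cmod (cinner (\<Sum>j<p. Z (s j) x) (Z n x)) < 1/2"
    by (auto simp: eventually_sequentially)
  show ?case
  proof (intro exI [of _ "s(p := n)"] ballI)
    fix x assume x: "x \<in> E"
    let ?u = "\<Sum>j<p. Z (s j) x"
    have "(norm (\<Sum>j<Suc p. Z ((s(p := n)) j) x))\<^sup>2 = (norm (?u + Z n x))\<^sup>2"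
      by simp
    also have "\<dots> = (norm ?u)\<^sup>2 + 2 * Re (cinner ?u (Z n x)) + (norm (Z n x))\<^sup>2"
      by (simp add: power2_norm_eq_inner inner_add_left inner_add_right inner_commute
          flip: inner_eq_Re_cinner)
    also have "\<dots> \<le> real p * (1 + (M * norm x)\<^sup>2) + 1 + (M * norm x)\<^sup>2"
      using s [OF x] n [OF x] complex_Re_le_cmod [of "cinner ?u (Z n x)"]
        power_mono [OF bound [of n x] norm_ge_zero, of 2] by linarith
    finally show "(norm (\<Sum>j<Suc p. Z ((s(p := n)) j) x))\<^sup>2 \<le> real (Suc p) * (1 + (M * norm x)\<^sup>2)"
      by (simp add: algebra_simps)
  qed
qed simp

text \<open>Stage m applies the Banach-Saks choice to the first m + 1 vectors of \<xi>; dividing by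
  m + 1 leaves a squared error of order 1 / (m + 1). Each \<open>\<xi> k\<close> is covered from
  stage k on, and averages stay in the subspace N with the same bound M.\<close>

lemma averages_converge_of_weak_limit:
  fixes Y :: "nat \<Rightarrow> 'a::chilbert_space \<Rightarrow> 'a" and \<xi> :: "nat \<Rightarrow> 'a"
  assumes N: "csubspace N" and Y: "\<And>n. Y n \<in> N"
    and bound: "\<And>n x. norm (Y n x) \<le> M * norm x" "\<And>x. norm (B x) \<le> M * norm x"
    and weak: "\<And>x y. (\<lambda>n. cinner y (Y n x)) \<longlonglongrightarrow> cinner y (B x)"
  obtains T where "\<And>m. T m \<in> N" "\<And>m x. norm (T m x) \<le> M * norm x"
    "\<And>k. (\<lambda>m. T m (\<xi> k)) \<longlonglongrightarrow> B (\<xi> k)"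
proof -
  have "\<exists>s::nat \<Rightarrow> nat. \<forall>x\<in>\<xi> ` {..m}. (norm (\<Sum>j<Suc m. Y (s j) x - B x))\<^sup>2
      \<le> real (Suc m) * (1 + (2 * M * norm x)\<^sup>2)" for m
  proof (rule small_sums_of_weakly_null [of "\<lambda>n x. Y n x - B x"])
    show "(\<lambda>n. cinner y (Y n x - B x)) \<longlonglongrightarrow> 0" for x y
      using tendsto_diff [OF weak [of y x] tendsto_const [of "cinner y (B x)"]]
      by (simp add: cinner_diff_right)
    show "norm (Y n x - B x) \<le> 2 * M * norm x" for n x
      using norm_triangle_ineq4 [of "Y n x" "B x"] bound(1) [of n x] bound(2) [of x] by simp
  qed simp
  then have "\<exists>s::nat \<Rightarrow> nat \<Rightarrow> nat. \<forall>m. \<forall>x\<in>\<xi> ` {..m}. (norm (\<Sum>j<Suc m. Y (s m j) x - B x))\<^sup>2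
      \<le> real (Suc m) * (1 + (2 * M * norm x)\<^sup>2)"
    by (intro choice allI)
  then obtain s :: "nat \<Rightarrow> nat \<Rightarrow> nat" where s: "\<And>m k. k \<le> m \<Longrightarrow>
      (norm (\<Sum>j<Suc m. Y (s m j) (\<xi> k) - B (\<xi> k)))\<^sup>2
      \<le> real (Suc m) * (1 + (2 * M * norm (\<xi> k))\<^sup>2)"
    by (elim exE) blast
  define T where "T m = complex_of_real (1 / real (Suc m)) *\<^sub>C (\<Sum>j<Suc m. Y (s m j))" for m
  have T: "T m x = (1 / real (Suc m)) *\<^sub>R (\<Sum>j<Suc m. Y (s m j) x)" for m x
  proof -
    have "(\<Sum>j\<in>J. Y (s m j)) x = (\<Sum>j\<in>J. Y (s m j) x)" if "finite J" for J
      using that by induction auto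
    then show ?thesis by (simp only: T_def scaleC_fun_def scaleR_eq_scaleC finite_lessThan)
  qed
  show ?thesis
  proof (rule that)
    show "T m \<in> N" for m
      unfolding T_def
      by (intro complex_vector.subspace_scale [OF N] complex_vector.subspace_sum [OF N] Y)
    show "norm (T m x) \<le> M * norm x" for m x
    proof -
      have "norm (\<Sum>j<Suc m. Y (s m j) x) \<le> (\<Sum>j<Suc m. M * norm x)"
        by (intro sum_norm_le bound)
      then show ?thesis by (simp add: T divide_simps mult.commute del: sum.lessThan_Suc)
    qed
    show "(\<lambda>m. T m (\<xi> k)) \<longlonglongrightarrow> B (\<xi> k)" for k
    proof -
      define c where "c = 1 + (2 * M * norm (\<xi> k))\<^sup>2"
      have est: "(norm (T m (\<xi> k) - B (\<xi> k)))\<^sup>2 \<le> c * (1 / real (Suc m))" if "m \<ge> k" for m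
      proof -
        have "T m (\<xi> k) - B (\<xi> k) = (1 / real (Suc m)) *\<^sub>R (\<Sum>j<Suc m. Y (s m j) (\<xi> k) - B (\<xi> k))"
          by (simp add: T sum_subtractf scaleR_diff_right sum_constant_scaleR del: sum.lessThan_Suc of_nat_Suc)
        then have "(norm (T m (\<xi> k) - B (\<xi> k)))\<^sup>2
            = (1 / real (Suc m))\<^sup>2 * (norm (\<Sum>j<Suc m. Y (s m j) (\<xi> k) - B (\<xi> k)))\<^sup>2"
          by (simp add: power_mult_distrib power_divide del: sum.lessThan_Suc of_nat_Suc)
        also have "\<dots> \<le> (1 / real (Suc m))\<^sup>2 * (real (Suc m) * c)"
          using s [OF that] unfolding c_def by (intro mult_left_mono) auto
        also have "\<dots> = c * (1 / real (Suc m))"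
          by (simp add: power2_eq_square del: of_nat_Suc)
        finally show ?thesis .
      qed
      have lim: "(\<lambda>m. c * (1 / real (Suc m))) \<longlonglongrightarrow> 0"
        using tendsto_mult [OF tendsto_const LIMSEQ_Suc [OF lim_1_over_n], of c] by simp
      have "(\<lambda>m. (norm (T m (\<xi> k) - B (\<xi> k)))\<^sup>2) \<longlonglongrightarrow> 0"
      proof (rule tendsto_sandwich [OF _ _ tendsto_const lim])
        show "\<forall>\<^sub>F m in sequentially. (norm (T m (\<xi> k) - B (\<xi> k)))\<^sup>2 \<le> c * (1 / real (Suc m))"
          unfolding eventually_sequentially using est by blast
      qed simp
      then have "(\<lambda>m. norm (T m (\<xi> k) - B (\<xi> k))) \<longlonglongrightarrow> 0"
        using tendsto_real_sqrt by fastforce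
      then show ?thesis by (simp add: tendsto_norm_zero_iff LIM_zero_iff)
    qed
  qed
qed

text \<open>Coefficients from a countable dense set of complex numbers suffice; coding the
  combinations by lists of pairs makes countability immediate.\<close>

lemma countable_dense_in_cspan:
  fixes F :: "'a::complex_inner set"
  assumes "countable F"
  obtains D where "countable D" "cspan F \<subseteq> closure D"
proof -
  obtain Q :: "complex set" where Q: "countable Q"
    "\<And>X. open X \<Longrightarrow> X \<noteq> {} \<Longrightarrow> \<exists>d\<in>Q. d \<in> X"
    using countable_dense_setE by blast
  define D where "D = (\<lambda>l. foldr (\<lambda>(q, f) y. q *\<^sub>C f + y) l 0) ` lists (Q \<times> F)"
  have D0: "0 \<in> D" unfolding D_def by (rule image_eqI [of _ _ "[]"]) auto
  have DC: "q *\<^sub>C f + y \<in> D" if "q \<in> Q" "f \<in> F" "y \<in> D" for q f y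
  proof -
    from \<open>y \<in> D\<close> obtain l where "l \<in> lists (Q \<times> F)" "y = foldr (\<lambda>(q, f) y. q *\<^sub>C f + y) l 0"
      by (auto simp: D_def)
    then show ?thesis
      unfolding D_def using that by (intro image_eqI [of _ _ "(q, f) # l"]) auto
  qed
  have dense: "x \<in> closure D" if "x \<in> cspan F" for x
    using that
  proof (induction rule: complex_vector.span_induct_alt)
    case base show ?case using D0 closure_subset by blast
  next
    case (step c f y)
    show ?case
      unfolding closure_approachable
    proof (intro allI impI)
      fix e :: real assume e: "e > 0"
      \<comment> \<open>The summand 1 in the denominator covers f = 0.\<close>
      define d where "d = e / 2 / (norm f + 1)"
      have nf: "norm f + 1 > 0" by (simp add: add_nonneg_pos)
      then have "d > 0" using e by (simp add: d_def)
      then obtain q where q: "q \<in> Q" "dist c q < d"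
        using Q(2) [of "ball c d"] by auto
      obtain z where z: "z \<in> D" "dist z y < e / 2"
        using step(2) e by (metis closure_approachable half_gt_zero)
      have "norm (q *\<^sub>C f - c *\<^sub>C f) = cmod (q - c) * norm f"
        by (metis complex_vector.scale_left_diff_distrib norm_scaleC)
      also have "\<dots> \<le> d * (norm f + 1)"
        using q \<open>d > 0\<close> by (intro mult_mono) (auto simp: dist_norm norm_minus_commute)
      also have "\<dots> = e / 2"
        unfolding d_def using nf by (intro nonzero_eq_divide_eq [THEN iffD1]) auto
      finally have "norm (q *\<^sub>C f - c *\<^sub>C f) \<le> e / 2" .
      then have "dist (q *\<^sub>C f + z) (c *\<^sub>C f + y) < e"
        using z(2) norm_triangle_ineq [of "q *\<^sub>C f - c *\<^sub>C f" "z - y"]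
        by (simp add: dist_norm add_diff_add)
      then show "\<exists>y'\<in>D. dist y' (c *\<^sub>C f + y) < e"
        using DC [OF q(1) step(1) z(1)] by blast
    qed
  qed
  have "countable D" unfolding D_def using Q assms by simp
  moreover have "cspan F \<subseteq> closure D" using dense by (rule subsetI)
  ultimately show ?thesis by (intro that)
qed

section \<open>The Weyl algebra as a strong sequential closure\<close>

lemma csubspace_preimage:
  fixes L :: "'a::complex_vector \<Rightarrow> 'b::complex_vector"
  assumes "csubspace S" "L 0 = 0" "\<And>x y. L (x + y) = L x + L y" "\<And>a x. L (a *\<^sub>C x) = a *\<^sub>C L x"
  shows "csubspace {x. L x \<in> S}"
  using assms by (simp add: complex_vector.subspace_def)

section \<open>Weyl operators and coherent vectors\<close>

locale cyclic_vacuum =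
  fixes W :: "'k::chilbert_space \<Rightarrow> 'h::chilbert_space \<Rightarrow> 'h" and \<Omega> :: 'h
  assumes cyclic_vacuum: "cyclic_vacuum_representation W \<Omega>"
begin

lemma W_unitary: "unitary_op (W f)"
  and W_comp: "W f \<circ> W g = exp (- (\<i> * complex_of_real (Im (cinner f g)))) *\<^sub>C W (f + g)"
  and vacuum_expectation: "cinner \<Omega> (W f \<Omega>) = complex_of_real (exp (- (1/2) * (norm f)\<^sup>2))"
  and total: "closure (cspan (range (\<lambda>f. W f \<Omega>))) = UNIV"
  using cyclic_vacuum
  unfolding cyclic_vacuum_representation_def vacuum_representation_def ccr_representation_def
  by blast+

lemma W_bounded: "bounded_op (W f)"
  using W_unitary unitary_op_def by blast

lemma W_mult: "W f (W g x) = exp (- (\<i> * complex_of_real (Im (cinner f g)))) *\<^sub>C W (f + g) x"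
  using fun_cong [OF W_comp, of f g x] by (simp add: scaleC_fun_def)

lemma W_isometry: "cinner (W f x) (W f y) = cinner x y"
proof -
  have "(cadjoint (W f) \<circ> W f) x = x"
    using W_unitary [of f] by (simp add: unitary_op_def)
  then show ?thesis
    by (metis W_bounded cinner_cadjoint_left comp_apply cadjoint_cadjoint bounded_op_cadjoint)
qed

lemma norm_W: "norm (W f x) = norm x"
proof -
  have "complex_of_real ((norm (W f x))\<^sup>2) = complex_of_real ((norm x)\<^sup>2)"
    by (simp only: cinner_self [symmetric] W_isometry)
  then show ?thesis by (simp only: of_real_eq_iff power2_eq_iff_nonneg norm_ge_zero)
qed

text \<open>The Weyl relation makes \<open>W 0\<close> idempotent, and an isometric idempotent is
  the identity.\<close>

lemma W_zero: "W 0 = id"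
proof (rule ext)
  fix x
  have "W 0 (W 0 x) = W 0 x" by (simp add: W_mult scaleC_one)
  then have "W 0 (W 0 x - x) = 0" by (simp add: bounded_op_diff [OF W_bounded])
  then have "norm (W 0 x - x) = 0" by (metis norm_W norm_zero)
  then show "W 0 x = id x" by simp
qed

lemma W_uminus: "W (- f) (W f x) = x"
  by (simp add: W_mult cinner_minus_left cinner_self W_zero scaleC_one)

lemma cadjoint_W: "cadjoint (W f) = W (- f)"
  by (rule cadjoint_unique) (metis W_isometry W_uminus)

text \<open>Moving \<open>W g\<close> to the other side and contracting the product to a single Weyl
  operator leaves a vacuum expectation; the phases complete the real parts of the mixed terms to
  full inner products.\<close>

lemma cinner_W_coherent:
  "cinner (W g \<Omega>) (W f (W h \<Omega>))
    = exp (- (complex_of_real ((norm f)\<^sup>2 + (norm g)\<^sup>2 + (norm h)\<^sup>2) / 2)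
        - cinner f h + cinner g f + cinner g h)"
proof -
  have "cinner (W g \<Omega>) (W f (W h \<Omega>)) = cinner \<Omega> (W (- g) (W f (W h \<Omega>)))"
    by (metis W_bounded cadjoint_W cinner_cadjoint_right)
  also have "W (- g) (W f (W h \<Omega>)) = (exp (- (\<i> * complex_of_real (Im (cinner f h))))
      * exp (\<i> * complex_of_real (Im (cinner g (f + h))))) *\<^sub>C W (f + h - g) \<Omega>"
    by (simp add: W_mult bounded_op_scaleC [OF W_bounded] scaleC_scaleC cinner_minus_left)
  also have "cinner \<Omega> \<dots> = exp (- (\<i> * complex_of_real (Im (cinner f h)))
      + \<i> * complex_of_real (Im (cinner g (f + h)))
      + complex_of_real (- (1/2) * (norm (f + h - g))\<^sup>2))"
    by (simp add: cinner_scaleC_right vacuum_expectation flip: exp_of_real exp_add)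
  also have "complex_of_real (- (1/2) * (norm (f + h - g))\<^sup>2)
      = - (cinner (f + h - g) (f + h - g) / 2)"
    by (simp add: cinner_self)
  also have "cinner (f + h - g) (f + h - g) = cinner f f + cinner h h + cinner g g
      + 2 * Re (cinner f h) - 2 * Re (cinner g (f + h))"
  proof -
    have "cinner x y + cinner y x = 2 * Re (cinner x y)" for x y :: 'k
      by (subst cinner_commute [of y x]) (simp add: complex_add_cnj)
    from this [of f h] this [of g "f + h"] show ?thesis
      by (simp add: cinner_add_left cinner_add_right cinner_diff_left cinner_diff_right algebra_simps)
  qed
  also have "- (\<i> * complex_of_real (Im (cinner f h))) + \<i> * complex_of_real (Im (cinner g (f + h)))
      + - ((cinner f f + cinner h h + cinner g g
      + 2 * Re (cinner f h) - 2 * Re (cinner g (f + h))) / 2)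
      = - (complex_of_real ((norm f)\<^sup>2 + (norm g)\<^sup>2 + (norm h)\<^sup>2) / 2)
        - cinner f h + cinner g (f + h)"
    by (simp add: cinner_self complex_eq_iff diff_divide_distrib add_divide_distrib)
  finally show ?thesis by (simp add: cinner_add_right add.assoc)
qed

lemma cinner_coherent:
  "cinner (W g \<Omega>) (W h \<Omega>)
    = exp (- (complex_of_real ((norm g)\<^sup>2 + (norm h)\<^sup>2) / 2) + cinner g h)"
  using cinner_W_coherent [of g 0 h] by (simp add: W_zero)

text \<open>Coherent vectors have norm 1, so their distance is governed by
  \<open>cinner_coherent\<close>, which is continuous in its arguments. This goes beyond the
  continuity along lines contained in \<open>ccr_representation\<close>.\<close>

lemma tendsto_coherent:
  assumes "d \<longlonglongrightarrow> k" shows "(\<lambda>n. W (d n) \<Omega>) \<longlonglongrightarrow> W k \<Omega>"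
proof -
  have norm1: "(norm (W f \<Omega>))\<^sup>2 = 1" for f
    using cinner_coherent [of f f] by (simp add: cinner_self flip: of_real_power)
  have "(norm (W f \<Omega> - W g \<Omega>))\<^sup>2 = 2 - 2 * Re (cinner (W f \<Omega>) (W g \<Omega>))" for f g
  proof -
    have "(norm (W f \<Omega> - W g \<Omega>))\<^sup>2
        = (norm (W f \<Omega>))\<^sup>2 + (norm (W g \<Omega>))\<^sup>2 - 2 * inner (W f \<Omega>) (W g \<Omega>)"
      by (simp add: power2_norm_eq_inner inner_diff_left inner_diff_right inner_commute)
    then show ?thesis by (simp add: norm1 inner_eq_Re_cinner)
  qed
  then have eq: "(norm (W (d n) \<Omega> - W k \<Omega>))\<^sup>2 = 2 - 2 * Re (exp (- (complex_of_real ((norm (d n))\<^sup>2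
      + (norm k)\<^sup>2) / 2) + cinner (d n) k))" for n
    by (simp add: cinner_coherent)
  have "(\<lambda>n. 2 - 2 * Re (exp (- (complex_of_real ((norm (d n))\<^sup>2 + (norm k)\<^sup>2) / 2) + cinner (d n) k)))
      \<longlonglongrightarrow> 2 - 2 * Re (exp (- (complex_of_real ((norm k)\<^sup>2 + (norm k)\<^sup>2) / 2) + cinner k k))"
    by (intro tendsto_intros tendsto_cinner_left assms) simp
  also have "2 - 2 * Re (exp (- (complex_of_real ((norm k)\<^sup>2 + (norm k)\<^sup>2) / 2) + cinner k k)) = 0"
    by (simp add: cinner_self)
  finally have "(\<lambda>n. (norm (W (d n) \<Omega> - W k \<Omega>))\<^sup>2) \<longlonglongrightarrow> 0"
    by (simp only: eq)
  then have "(\<lambda>n. norm (W (d n) \<Omega> - W k \<Omega>)) \<longlonglongrightarrow> 0"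
    using tendsto_real_sqrt by fastforce
  then show ?thesis by (simp add: tendsto_norm_zero_iff LIM_zero_iff)
qed

section \<open>The span of the Weyl operators as an algebra closed under adjoints\<close>

lemma W_in_weyl_span: "W f \<in> weyl_span W"
  unfolding weyl_span_def by (simp add: complex_vector.span_base)

lemma csubspace_weyl_span: "csubspace (weyl_span W)"
  unfolding weyl_span_def by (rule complex_vector.subspace_span)

lemma weyl_span_bounded: "A \<in> weyl_span W \<Longrightarrow> bounded_op A"
  using complex_vector.span_minimal [OF _ csubspace_bounded_op, of "range W"] W_bounded
  unfolding weyl_span_def by blast

lemma weyl_span_induct [consumes 1, case_names W subspace]:
  assumes "A \<in> weyl_span W" "\<And>f. P (W f)" "csubspace {A. P A}" shows "P A"
  using assms complex_vector.span_minimal [of "range W" "{A. P A}"] by (auto simp: weyl_span_def)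

lemma weyl_span_comp:
  assumes A: "A \<in> weyl_span W" and B: "B \<in> weyl_span W" shows "A \<circ> B \<in> weyl_span W"
proof -
  note sub = csubspace_weyl_span
  have zero: "A 0 = 0" if "bounded_op A" for A :: "'h \<Rightarrow> 'h"
    using bounded_op_diff [OF that, of 0 0] by simp
  have 1: "W f \<circ> B \<in> weyl_span W" for f
    using B
  proof (induction rule: weyl_span_induct)
    case (W g)
    then show ?case
      unfolding W_comp by (intro complex_vector.subspace_scale [OF sub] W_in_weyl_span)
  next
    case subspace
    have "W f \<circ> 0 = 0" "W f \<circ> (X + Y) = (W f \<circ> X) + (W f \<circ> Y)" "W f \<circ> (a *\<^sub>C X) = a *\<^sub>C (W f \<circ> X)" for X Y a
      using W_bounded [of f]
      by (simp_all add: fun_eq_iff bounded_op_add bounded_op_scaleC scaleC_fun_def zero)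
    then show ?case by (intro csubspace_preimage sub)
  qed
  show ?thesis
    using A
  proof (induction rule: weyl_span_induct)
    case (W f) show ?case by (rule 1)
  next
    case subspace
    have "0 \<circ> B = 0" "(X + Y) \<circ> B = (X \<circ> B) + (Y \<circ> B)" "(a *\<^sub>C X) \<circ> B = a *\<^sub>C (X \<circ> B)" for X Y a
      by (simp_all add: fun_eq_iff scaleC_fun_def)
    then show ?case by (intro csubspace_preimage sub)
  qed
qed

lemma weyl_span_cadjoint:
  assumes "A \<in> weyl_span W" shows "cadjoint A \<in> weyl_span W"
proof -
  note sub = csubspace_weyl_span
  \<comment> \<open>Boundedness is part of the induction predicate because the rules for adjoints of
    sums and multiples require it.\<close>
  have "bounded_op A \<and> cadjoint A \<in> weyl_span W"
    using assms
  proof (induction rule: weyl_span_induct)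
    case (W f)
    show ?case by (simp add: W_bounded cadjoint_W W_in_weyl_span)
  next
    case subspace
    have "cadjoint 0 = (0 :: 'h \<Rightarrow> 'h)" by (rule cadjoint_unique) simp
    then show ?case
      unfolding complex_vector.subspace_def
      using complex_vector.subspace_0 [OF sub] complex_vector.subspace_add [OF sub]
        complex_vector.subspace_scale [OF sub]
      by (simp add: bounded_op_zero bounded_op_plus bounded_op_scale cadjoint_plus cadjoint_scaleC)
  qed
  then show ?thesis by blast
qed

section \<open>Closedness of the strong closure under adjoints\<close>

abbreviation (input) \<N> where "\<N> \<equiv> strong_closure (weyl_span W)"

lemma strong_closure_weyl_bounded: "A \<in> \<N> \<Longrightarrow> bounded_op A"
  using strong_closure_bounded_op weyl_span_bounded by blast

lemma csubspace_commutant: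
  assumes "bounded_op B" shows "csubspace {A. A \<circ> B = B \<circ> A}"
  using assms bounded_op_diff [OF assms, of 0 0]
  by (simp add: complex_vector.subspace_def fun_eq_iff bounded_op_add bounded_op_scaleC scaleC_fun_def)

text \<open>For \<open>W f\<close> the set {f} works, a linear combination needs finitely many such
  f, and the limit of a sequence needs a countable union of countable sets.\<close>

lemma countable_support:
  assumes "A \<in> \<N>"
  shows "\<exists>F. countable F \<and> (\<forall>h. (\<forall>f\<in>F. cinner f h = 0) \<longrightarrow> A \<circ> W h = W h \<circ> A)"
  using assms
proof (induction rule: strong_closure_induct)
  case (base A)
  from base show ?case
    unfolding weyl_span_def
  proof (induction rule: complex_vector.span_induct_alt)
    case base
    show ?case
      using complex_vector.subspace_0 [OF csubspace_commutant [OF W_bounded]] countable_empty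
      by blast
  next
    case (step c A B)
    then obtain F f where F: "countable F" "\<And>h. (\<forall>f\<in>F. cinner f h = 0) \<Longrightarrow> B \<circ> W h = W h \<circ> B"
      and A: "A = W f" by blast
    \<comment> \<open>Orthogonality makes both phases trivial, so either product is
      \<open>W (f + h)\<close>.\<close>
    have "W f \<circ> W h = W h \<circ> W f" if "cinner f h = 0" for h
    proof -
      have "cinner h f = 0" by (metis that cinner_commute complex_cnj_zero)
      with that show ?thesis by (simp add: W_comp add.commute)
    qed
    then have "c *\<^sub>C A + B \<in> {A. A \<circ> W h = W h \<circ> A}" if "\<forall>f\<in>insert f F. cinner f h = 0" for h
      using that F(2) [of h] unfolding A
      by (intro complex_vector.subspace_add complex_vector.subspace_scale csubspace_commutant W_bounded)
        blast+
    then show ?case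
      using F(1) by (intro exI [of _ "insert f F"]) blast
  qed
next
  case (limit X A)
  then obtain F where F: "\<And>n. countable (F n)"
    "\<And>n h. (\<forall>f\<in>F n. cinner f h = 0) \<Longrightarrow> X n \<circ> W h = W h \<circ> X n"
    by metis
  have "A \<circ> W h = W h \<circ> A" if h: "\<forall>f\<in>(\<Union>n. F n). cinner f h = 0" for h
  proof
    fix x
    have "X n (W h x) = W h (X n x)" for n
      using F(2) [of n h] h by (metis UN_I UNIV_I comp_apply)
    moreover have lim: "(\<lambda>n. X n y) \<longlonglongrightarrow> A y" for y
      using \<open>strongly_tendsto X A\<close> unfolding strongly_tendsto_def by blast
    moreover have "(\<lambda>n. W h (X n x)) \<longlonglongrightarrow> W h (A x)"
      by (rule bounded_op_tendsto [OF W_bounded lim])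
    ultimately show "(A \<circ> W h) x = (W h \<circ> A) x"
      using LIMSEQ_unique by (metis (no_types, lifting) comp_apply ext)
  qed
  then show ?case using F(1) by (intro exI [of _ "\<Union>n. F n"]) auto
qed

text \<open>Convergence of the averaged adjoints spreads in stages: from \<open>W d \<Omega>\<close>
  with d in a countable set to \<open>W k \<Omega>\<close> with k in the closed span of F by
  continuity, to all coherent vectors by commutation with \<open>W z\<close> for z orthogonal to F,
  and to all vectors by totality.\<close>

lemma cadjoint_limit_in_strong_closure:
  assumes X: "\<And>n. X n \<in> \<N>" and adj: "\<And>n. cadjoint (X n) \<in> \<N>"
    and A: "bounded_op A" "strongly_tendsto X A"
  shows "cadjoint A \<in> \<N>"
proof -
  have bX: "bounded_op (X n)" for n using X strong_closure_weyl_bounded by blast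
  have "A \<in> \<N>" using X A by (blast intro: strong_closure.limit)
  then obtain F0 where F0: "countable F0" "\<And>h. (\<forall>f\<in>F0. cinner f h = 0) \<Longrightarrow> A \<circ> W h = W h \<circ> A"
    using countable_support by blast
  obtain F1 where F1: "\<And>n. countable (F1 n)"
    "\<And>n h. (\<forall>f\<in>F1 n. cinner f h = 0) \<Longrightarrow> cadjoint (X n) \<circ> W h = W h \<circ> cadjoint (X n)"
    using countable_support [OF adj] by metis
  \<comment> \<open>F supports the limit and all the adjoints at once.\<close>
  define F where "F = F0 \<union> (\<Union>n. F1 n)"
  have "countable F" unfolding F_def using F0(1) F1(1) by auto
  then obtain D where D: "countable D" "cspan F \<subseteq> closure D"
    using countable_dense_in_cspan by blast
  \<comment> \<open>Being a subspace, \<open>N'\<close> also contains the averages, which therefore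
    commute with the same \<open>W z\<close>.\<close>
  define N' where "N' = \<N> \<inter> (\<Inter>z\<in>{z. \<forall>f\<in>F. cinner f z = 0}. {B. B \<circ> W z = W z \<circ> B})"
  have N': "csubspace N'"
    unfolding N'_def
    by (intro complex_vector.subspace_inter complex_vector.subspace_Int csubspace_strong_closure
        csubspace_weyl_span weyl_span_bounded csubspace_commutant W_bounded)
  have Y: "cadjoint (X n) \<in> N'" for n
    using adj F1(2) [where n = n] unfolding N'_def F_def by blast
  define B where "B = cadjoint A"
  have bB: "bounded_op B" unfolding B_def by (intro bounded_op_cadjoint A)
  obtain M where M: "M \<ge> 0" "\<And>n x. norm (X n x) \<le> M * norm x"
    using strongly_tendsto_bound [OF bX A(2)] by blast
  have MA: "norm (A x) \<le> M * norm x" for x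
    using A(2) M(2) [of _ x] unfolding strongly_tendsto_def
    by (intro Lim_norm_ubound [of sequentially "\<lambda>n. X n x"]) auto
  have bounds: "norm (cadjoint (X n) x) \<le> M * norm x" "norm (B x) \<le> M * norm x" for n x
    unfolding B_def by (intro norm_cadjoint_le bX M A MA)+
  have weak: "(\<lambda>n. cinner y (cadjoint (X n) x)) \<longlonglongrightarrow> cinner y (B x)" for x y
    using A(2) unfolding B_def
    by (simp add: cinner_cadjoint_right bX A strongly_tendsto_def tendsto_cinner_left)
  define \<xi> where "\<xi> k = W (from_nat_into D k) \<Omega>" for k
  obtain T where T: "\<And>m. T m \<in> N'" "\<And>m x. norm (T m x) \<le> M * norm x"
    "\<And>k. (\<lambda>m. T m (\<xi> k)) \<longlonglongrightarrow> B (\<xi> k)"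
    using averages_converge_of_weak_limit [OF N' Y bounds weak, of \<xi>] by blast
  have bT: "bounded_op (T m)" for m
    using T(1) [of m] strong_closure_weyl_bounded by (simp add: N'_def)
  have cl: "closed {x. (\<lambda>m. T m x) \<longlonglongrightarrow> B x}"
    by (rule closed_convergence [OF bT M(1) T(2) bB])
  have conv: "(\<lambda>m. T m (W k \<Omega>)) \<longlonglongrightarrow> B (W k \<Omega>)" if k: "k \<in> closure (cspan F)" for k
  proof -
    have "k \<in> closure D" using k D(2) closure_minimal by blast
    then obtain d where d: "\<And>n. d n \<in> D" "d \<longlonglongrightarrow> k" by (auto simp: closure_sequential)
    have "W (d n) \<Omega> \<in> {x. (\<lambda>m. T m x) \<longlonglongrightarrow> B x}" for n
      using T(3) [of "to_nat_on D (d n)"] d(1) [of n] D(1) by (simp add: \<xi>_def)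
    then show ?thesis
      using closed_sequentially [OF cl _ tendsto_coherent [OF d(2)]] by blast
  qed
  have "strongly_tendsto T B"
    unfolding strongly_tendsto_def
  proof (intro allI, rule total_induct [OF total, where P = "\<lambda>x. (\<lambda>m. T m x) \<longlonglongrightarrow> B x"])
    fix s assume "s \<in> range (\<lambda>f. W f \<Omega>)"
    then obtain f where s: "s = W f \<Omega>" by blast
    \<comment> \<open>Orthogonality of k and z means that no phase appears when
      \<open>W (k + z)\<close> is factored below.\<close>
    obtain k z where f: "f = k + z" and k: "k \<in> closure (cspan F)"
      and z: "\<And>s. s \<in> closure (cspan F) \<Longrightarrow> cinner s z = 0"
      using orthogonal_decomposition [of "closure (cspan F)" f] csubspace_closure
        complex_vector.subspace_span by (metis closed_closure)
    have zF: "cinner f z = 0" if "f \<in> F" for f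
      using z that closure_subset complex_vector.span_base by blast
    have "cinner z k = 0" using z [OF k] by (metis cinner_commute complex_cnj_zero)
    then have s': "s = W z (W k \<Omega>)" by (simp add: s f W_mult scaleC_one add.commute)
    have TW: "T m (W z x) = W z (T m x)" for m x
      using T(1) [of m] zF unfolding N'_def by (auto simp: fun_eq_iff)
    \<comment> \<open>The sign is chosen because taking adjoints turns \<open>W (- z)\<close> into
      \<open>W z\<close>.\<close>
    have "A \<circ> W (- z) = W (- z) \<circ> A"
      using zF by (intro F0(2)) (auto simp: F_def cinner_minus_right)
    then have "cadjoint (A \<circ> W (- z)) = cadjoint (W (- z) \<circ> A)" by simp
    then have "W z \<circ> B = B \<circ> W z"
      by (simp add: cadjoint_comp A W_bounded cadjoint_W B_def)
    then have "B (W z x) = W z (B x)" for x by (metis comp_apply)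
    then show "(\<lambda>m. T m s) \<longlonglongrightarrow> B s"
      using conv [OF k] by (simp add: s' TW bounded_op_tendsto [OF W_bounded])
  qed (intro csubspace_convergence bT bB cl)+
  moreover have "\<forall>m. T m \<in> \<N>" using T(1) by (simp add: N'_def)
  ultimately show ?thesis
    using bB unfolding B_def by (intro strong_closure.limit [of T])
qed

lemma strong_closure_cadjoint: "A \<in> \<N> \<Longrightarrow> cadjoint A \<in> \<N>"
proof (induction rule: strong_closure_induct)
  case (base A) then show ?case by (intro strong_closure.base weyl_span_cadjoint)
next
  case (limit X A)
  show ?case
    by (rule cadjoint_limit_in_strong_closure [OF limit.hyps(1) limit.IH limit.hyps(2,3)])
qed

text \<open>The strong closure is itself a von Neumann algebra, and every von Neumann algebra
  containing the span absorbs its iterated limits. The result makes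
  \<open>strong_closure_induct\<close> available for \<open>weyl_algebra\<close>.\<close>

theorem weyl_algebra_eq_strong_closure: "weyl_algebra W = strong_closure (weyl_span W)"
proof
  have "von_neumann_algebra \<N>"
    unfolding von_neumann_algebra_def
  proof (intro conjI allI ballI impI)
    show "id \<in> \<N>" using W_in_weyl_span [of 0] by (simp add: W_zero strong_closure.base)
    show "csubspace \<N>" by (intro csubspace_strong_closure csubspace_weyl_span weyl_span_bounded)
    show "A \<circ> B \<in> \<N>" if "A \<in> \<N>" "B \<in> \<N>" for A B
      using that
      by (intro strong_closure_comp csubspace_weyl_span weyl_span_bounded weyl_span_comp)
    show "A \<in> \<N>" if "(\<forall>n. X n \<in> \<N>) \<and> bounded_op A \<and> strongly_tendsto X A" for X A
      using that by (blast intro: strong_closure.limit)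
  qed (use strong_closure_weyl_bounded strong_closure_cadjoint in auto)
  then show "weyl_algebra W \<subseteq> \<N>"
    unfolding weyl_algebra_def von_neumann_generated_def
    by (auto intro: strong_closure.base)
  have "A \<in> M" if "A \<in> \<N>" "von_neumann_algebra M" "weyl_span W \<subseteq> M" for A M
    using that(1)
  proof (induction rule: strong_closure_induct)
    case (base A) then show ?case using that(3) by blast
  next
    case (limit X A)
    then show ?case using that(2) unfolding von_neumann_algebra_def by blast
  qed
  then show "\<N> \<subseteq> weyl_algebra W"
    unfolding weyl_algebra_def von_neumann_generated_def by blast
qed

end

section \<open>Positive semidefinite kernels and operators defined by kernels\<close>

text \<open>Hermitian symmetry is demanded separately, since nonnegativity of the real part alone
  does not imply it.\<close>

definition psd_kernel :: "'i set \<Rightarrow> ('i \<Rightarrow> 'i \<Rightarrow> complex) \<Rightarrow> bool" where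
  "psd_kernel T q \<longleftrightarrow> (\<forall>g\<in>T. \<forall>h\<in>T. q h g = cnj (q g h)) \<and>
     (\<forall>a. 0 \<le> Re (\<Sum>g\<in>T. \<Sum>h\<in>T. cnj (a g) * a h * q g h))"

lemma psd_kernel_hermitian: "psd_kernel T q \<Longrightarrow> g \<in> T \<Longrightarrow> h \<in> T \<Longrightarrow> q h g = cnj (q g h)"
  and psd_kernel_nonneg: "psd_kernel T q \<Longrightarrow> 0 \<le> Re (\<Sum>g\<in>T. \<Sum>h\<in>T. cnj (a g) * a h * q g h)"
  unfolding psd_kernel_def by blast+

lemma psd_kernel_subset:
  assumes q: "psd_kernel T q" and S: "S \<subseteq> T" "finite T" shows "psd_kernel S q"
  unfolding psd_kernel_def
proof (intro conjI ballI allI)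
  show "q h g = cnj (q g h)" if "g \<in> S" "h \<in> S" for g h
    using psd_kernel_hermitian [OF q] that S by blast
  fix a :: "'a \<Rightarrow> complex"
  define b where "b g = (if g \<in> S then a g else 0)" for g
  have "(\<Sum>g\<in>T. \<Sum>h\<in>T. cnj (b g) * b h * q g h) = (\<Sum>g\<in>S. \<Sum>h\<in>T. cnj (b g) * b h * q g h)"
    using S by (intro sum.mono_neutral_right) (auto simp: b_def)
  also have "\<dots> = (\<Sum>g\<in>S. \<Sum>h\<in>S. cnj (b g) * b h * q g h)"
    using S by (intro sum.cong sum.mono_neutral_right) (auto simp: b_def)
  also have "\<dots> = (\<Sum>g\<in>S. \<Sum>h\<in>S. cnj (a g) * a h * q g h)"
    by (intro sum.cong) (auto simp: b_def)
  finally show "0 \<le> Re (\<Sum>g\<in>S. \<Sum>h\<in>S. cnj (a g) * a h * q g h)"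
    using psd_kernel_nonneg [OF q, of b] by simp
qed

lemma double_sum_insert:
  fixes f :: "'i \<Rightarrow> 'i \<Rightarrow> 'b::comm_monoid_add"
  assumes "finite T" "t \<notin> T"
  shows "(\<Sum>g\<in>insert t T. \<Sum>h\<in>insert t T. f g h)
    = f t t + (\<Sum>h\<in>T. f t h) + (\<Sum>g\<in>T. f g t) + (\<Sum>g\<in>T. \<Sum>h\<in>T. f g h)"
  using assms by (simp add: sum.distrib ac_simps)

text \<open>Cholesky factorization; the step passes to the Schur complement of the diagonal entry at \<open>t\<close>.\<close>

lemma psd_kernel_gram:
  assumes "finite T" "psd_kernel T q"
  shows "\<exists>M. \<forall>g\<in>T. \<forall>h\<in>T. q g h = (\<Sum>r\<in>T. cnj (M r g) * M r h)"
  using assms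
proof (induction T arbitrary: q rule: finite_induct)
  case (insert t T)
  note herm = psd_kernel_hermitian [OF insert.prems]
  define s where "s = Re (q t t)"
  have qtt: "q t t = complex_of_real s"
    using herm [of t t] by (simp add: s_def complex_eq_iff)
  have "psd_kernel {t} q"
    using insert by (intro psd_kernel_subset [OF insert.prems]) auto
  from psd_kernel_nonneg [OF this, of "\<lambda>_. 1"] have s0: "s \<ge> 0"
    by (simp add: s_def)
  have zero: "q t h = 0" if s: "s = 0" and h: "h \<in> T" for h
  proof (rule ccontr)
    assume nz: "q t h \<noteq> 0"
    have "psd_kernel {t, h} q"
      using insert h by (intro psd_kernel_subset [OF insert.prems]) auto
    \<comment> \<open>This c makes the quadratic form below equal to -1, contradicting
      positivity.\<close>
    define c where "c = (Re (q h h) + 1) / (2 * (cmod (q t h))\<^sup>2)"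
    have "t \<noteq> h" using h insert by auto
    have "0 \<le> Re (\<Sum>g\<in>{t, h}. \<Sum>k\<in>{t, h}. cnj (if g = t then - c * q t h else 1)
        * (if k = t then - c * q t h else 1) * q g k)"
      using psd_kernel_nonneg [OF \<open>psd_kernel {t, h} q\<close>, of "\<lambda>g. if g = t then - c * q t h else 1"] .
    also have "\<dots> = Re (q h h) - 2 * c * (cmod (q t h))\<^sup>2"
      using \<open>t \<noteq> h\<close> h
      by (simp add: qtt s herm [of t h] cmod_power2) (simp add: algebra_simps power2_eq_square)
    also have "\<dots> = - 1" using nz by (simp add: c_def field_simps)
    finally show False by simp
  qed
  define q' where "q' g h = q g h - cnj (q t g) * q t h / complex_of_real s" for g h
  have "psd_kernel T q'"
    unfolding psd_kernel_def
  proof (intro conjI ballI allI)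
    show "q' h g = cnj (q' g h)" if "g \<in> T" "h \<in> T" for g h
      using herm [of g h] that by (simp add: q'_def mult.commute)
    fix a :: "'a \<Rightarrow> complex"
    define u where "u = (\<Sum>h\<in>T. a h * q t h)"
    \<comment> \<open>Completing the square in the coordinate t turns the form of q at b into the
      form of \<open>q'\<close> at a. For s = 0 the quotients are 0 by convention.\<close>
    define b where "b g = (if g = t then - u / complex_of_real s else a g)" for g
    have b: "b g = a g" if "g \<in> T" for g using that insert by (auto simp: b_def)
    have u': "(\<Sum>g\<in>T. cnj (a g) * q g t) = cnj u"
      unfolding u_def cnj_sum by (intro sum.cong) (auto simp: herm [OF insertI1 insertI2])
    have uu: "(\<Sum>g\<in>T. \<Sum>h\<in>T. cnj (a g) * a h * (cnj (q t g) * q t h)) = cnj u * u"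
      unfolding u_def cnj_sum sum_product by (intro sum.cong) auto
    have "(\<Sum>g\<in>insert t T. \<Sum>h\<in>insert t T. cnj (b g) * b h * q g h)
      = cnj (b t) * b t * q t t + cnj (b t) * u + cnj u * b t
        + (\<Sum>g\<in>T. \<Sum>h\<in>T. cnj (a g) * a h * q g h)"
    proof -
      have "(\<Sum>h\<in>T. cnj (b t) * b h * q t h) = cnj (b t) * u"
        unfolding u_def sum_distrib_left by (intro sum.cong) (auto simp: b)
      moreover have "(\<Sum>g\<in>T. cnj (b g) * b t * q g t) = cnj u * b t"
        unfolding u' [symmetric] sum_distrib_right by (intro sum.cong) (auto simp: b)
      moreover have "(\<Sum>g\<in>T. \<Sum>h\<in>T. cnj (b g) * b h * q g h)
          = (\<Sum>g\<in>T. \<Sum>h\<in>T. cnj (a g) * a h * q g h)"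
        by (intro sum.cong) (auto simp: b)
      ultimately show ?thesis
        by (simp add: double_sum_insert [OF insert.hyps])
    qed
    also have "\<dots> = (\<Sum>g\<in>T. \<Sum>h\<in>T. cnj (a g) * a h * q g h) - cnj u * u / complex_of_real s"
      by (cases "s = 0") (simp_all add: qtt b_def field_simps)
    also have "\<dots> = (\<Sum>g\<in>T. \<Sum>h\<in>T. cnj (a g) * a h * q' g h)"
      unfolding q'_def uu [symmetric]
      by (simp add: right_diff_distrib sum_subtractf sum_divide_distrib)
    finally show "0 \<le> Re (\<Sum>g\<in>T. \<Sum>h\<in>T. cnj (a g) * a h * q' g h)"
      using psd_kernel_nonneg [OF insert.prems, of b] by simp
  qed
  then obtain M' where M': "\<And>g h. g \<in> T \<Longrightarrow> h \<in> T \<Longrightarrow> q' g h = (\<Sum>r\<in>T. cnj (M' r g) * M' r h)"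
    using insert.IH by blast
  \<comment> \<open>The factor is triangular: the old rows vanish in column t, so row t alone
    reproduces the entries of q that involve t. For s = 0 those entries vanish by
    \<open>zero\<close> and \<open>qtt\<close>.\<close>
  define M where "M r h = (if r = t then q t h / complex_of_real (sqrt s) else if h = t then 0 else M' r h)"
    for r h
  have ss: "complex_of_real (sqrt s) * complex_of_real (sqrt s) = complex_of_real s"
    using s0 by (simp flip: of_real_mult)
  have Mt: "cnj (M t g) * M t h = cnj (q t g) * q t h / complex_of_real s" for g h
    by (simp add: M_def ss)
  have ne: "r \<noteq> t" if "r \<in> T" for r using that insert by auto
  have "q g h = (\<Sum>r\<in>insert t T. cnj (M r g) * M r h)"
    if "g \<in> insert t T" "h \<in> insert t T" for g h
  proof -
    have eq: "(\<Sum>r\<in>insert t T. cnj (M r g) * M r h)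
        = cnj (q t g) * q t h / complex_of_real s + (\<Sum>r\<in>T. cnj (M r g) * M r h)"
      using insert.hyps by (simp add: Mt)
    show ?thesis
    proof (cases "g \<in> T \<and> h \<in> T")
      case True
      then have "(\<Sum>r\<in>T. cnj (M r g) * M r h) = q' g h"
        using M' [of g h] ne by (simp add: M_def cong: sum.cong)
      then show ?thesis by (simp only: eq q'_def) simp
    next
      case False
      then have "(\<Sum>r\<in>T. cnj (M r g) * M r h) = 0"
        using that ne by (auto simp: M_def intro!: sum.neutral)
      moreover have "q g h = cnj (q t g) * q t h / complex_of_real s"
      proof (cases "s = 0")
        case True
        then show ?thesis
          using False that zero herm [of t g] qtt by auto
      next
        case s: False
        then show ?thesis
          using False that herm [of t g] qtt by auto
      qed
      ultimately show ?thesis by (simp add: eq)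
    qed
  qed
  then show ?case by blast
qed simp

text \<open>The Schur product theorem: a Gram factor M of p splits the form of the product into
  forms of q, one per row r, with coefficients \<open>a g * M r g\<close>.\<close>

lemma psd_kernel_mult:
  assumes "finite T" "psd_kernel T p" "psd_kernel T q"
  shows "psd_kernel T (\<lambda>g h. p g h * q g h)"
proof -
  obtain M where M: "\<And>g h. g \<in> T \<Longrightarrow> h \<in> T \<Longrightarrow> p g h = (\<Sum>r\<in>T. cnj (M r g) * M r h)"
    using psd_kernel_gram [OF assms(1,2)] by blast
  show ?thesis
    unfolding psd_kernel_def
  proof (intro conjI ballI allI)
    show "p h g * q h g = cnj (p g h * q g h)" if "g \<in> T" "h \<in> T" for g h
      using psd_kernel_hermitian [OF assms(2) that] psd_kernel_hermitian [OF assms(3) that]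
      by (metis complex_cnj_mult)
    fix a :: "'a \<Rightarrow> complex"
    have "(\<Sum>g\<in>T. \<Sum>h\<in>T. cnj (a g) * a h * (p g h * q g h))
        = (\<Sum>g\<in>T. \<Sum>h\<in>T. \<Sum>r\<in>T. cnj (a g * M r g) * (a h * M r h) * q g h)"
      by (intro sum.cong) (simp_all add: M sum_distrib_left sum_distrib_right mult_ac)
    also have "\<dots> = (\<Sum>g\<in>T. \<Sum>r\<in>T. \<Sum>h\<in>T. cnj (a g * M r g) * (a h * M r h) * q g h)"
      by (intro sum.cong refl sum.swap)
    also have "\<dots> = (\<Sum>r\<in>T. \<Sum>g\<in>T. \<Sum>h\<in>T. cnj (a g * M r g) * (a h * M r h) * q g h)"
      by (rule sum.swap)
    finally have "Re (\<Sum>g\<in>T. \<Sum>h\<in>T. cnj (a g) * a h * (p g h * q g h))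
        = (\<Sum>r\<in>T. Re (\<Sum>g\<in>T. \<Sum>h\<in>T. cnj (a g * M r g) * (a h * M r h) * q g h))"
      by (simp only: Re_sum [of "\<lambda>r. \<Sum>g\<in>T. \<Sum>h\<in>T. cnj (a g * M r g) * (a h * M r h) * q g h"])
    then show "0 \<le> Re (\<Sum>g\<in>T. \<Sum>h\<in>T. cnj (a g) * a h * (p g h * q g h))"
      using psd_kernel_nonneg [OF assms(3)] by (simp only: sum_nonneg)
  qed
qed

text \<open>Kernels of rank one: the constant 1 starts the powers below, and other choices of c
  rescale a kernel.\<close>

lemma psd_kernel_conj:
  "psd_kernel T (\<lambda>g h. cnj (c g) * c h)"
  unfolding psd_kernel_def
proof (intro conjI ballI allI)
  fix a :: "'a \<Rightarrow> complex"
  have "(\<Sum>g\<in>T. \<Sum>h\<in>T. cnj (a g) * a h * (cnj (c g) * c h)) = cnj (\<Sum>g\<in>T. a g * c g) * (\<Sum>g\<in>T. a g * c g)"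
    unfolding cnj_sum sum_product by (intro sum.cong) auto
  moreover have "0 \<le> Re (cnj z * z)" for z by simp
  ultimately show "0 \<le> Re (\<Sum>g\<in>T. \<Sum>h\<in>T. cnj (a g) * a h * (cnj (c g) * c h))"
    by presburger
qed simp

lemma psd_kernel_power: "finite T \<Longrightarrow> psd_kernel T q \<Longrightarrow> psd_kernel T (\<lambda>g h. q g h ^ n)"
  by (induction n) (use psd_kernel_conj [of T "\<lambda>_. 1"] psd_kernel_mult in auto)

lemma psd_kernel_add:
  assumes p: "psd_kernel T p" and q: "psd_kernel T q"
  shows "psd_kernel T (\<lambda>g h. p g h + q g h)"
  unfolding psd_kernel_def
proof (intro conjI ballI allI)
  show "p h g + q h g = cnj (p g h + q g h)" if "g \<in> T" "h \<in> T" for g h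
    using psd_kernel_hermitian [OF p that] psd_kernel_hermitian [OF q that] by (metis complex_cnj_add)
  fix a :: "'a \<Rightarrow> complex"
  show "0 \<le> Re (\<Sum>g\<in>T. \<Sum>h\<in>T. cnj (a g) * a h * (p g h + q g h))"
    using psd_kernel_nonneg [OF p, of a] psd_kernel_nonneg [OF q, of a]
    by (simp add: distrib_left sum.distrib)
qed

lemma psd_kernel_scale:
  assumes "finite T" "r \<ge> 0" "psd_kernel T q"
  shows "psd_kernel T (\<lambda>g h. complex_of_real r * q g h)"
proof -
  have "cnj (complex_of_real (sqrt r)) * complex_of_real (sqrt r) = complex_of_real r"
    using assms(2) by (simp flip: of_real_mult)
  then show ?thesis
    using psd_kernel_mult [OF assms(1) psd_kernel_conj [of T "\<lambda>_. complex_of_real (sqrt r)"] assms(3)]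
    by simp
qed

lemma psd_kernel_limit:
  assumes "\<And>n. psd_kernel T (q n)" "\<And>g h. (\<lambda>n. q n g h) \<longlonglongrightarrow> p g h"
  shows "psd_kernel T p"
  unfolding psd_kernel_def
proof (intro conjI ballI allI)
  show "p h g = cnj (p g h)" if "g \<in> T" "h \<in> T" for g h
  proof (rule LIMSEQ_unique)
    show "(\<lambda>n. q n h g) \<longlonglongrightarrow> p h g" by (rule assms)
    have "q n h g = cnj (q n g h)" for n using psd_kernel_hermitian [OF assms(1)] that by blast
    then show "(\<lambda>n. q n h g) \<longlonglongrightarrow> cnj (p g h)"
      using tendsto_cnj [OF assms(2)] by simp
  qed
  fix a :: "'a \<Rightarrow> complex"
  have "(\<lambda>n. Re (\<Sum>g\<in>T. \<Sum>h\<in>T. cnj (a g) * a h * q n g h))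
      \<longlonglongrightarrow> Re (\<Sum>g\<in>T. \<Sum>h\<in>T. cnj (a g) * a h * p g h)"
    by (intro tendsto_intros assms)
  then show "0 \<le> Re (\<Sum>g\<in>T. \<Sum>h\<in>T. cnj (a g) * a h * p g h)"
    by (rule LIMSEQ_le_const) (use psd_kernel_nonneg [OF assms(1)] in blast)
qed

text \<open>Partial sums of the exponential series are combinations of Schur powers with nonnegative
  coefficients, and positivity survives the pointwise limit.\<close>

lemma psd_kernel_exp:
  assumes T: "finite T" and q: "psd_kernel T q" shows "psd_kernel T (\<lambda>g h. exp (q g h))"
proof (rule psd_kernel_limit)
  show "psd_kernel T (\<lambda>g h. \<Sum>n<N. complex_of_real (1 / fact n) * q g h ^ n)" for N
  proof (induction N)
    case 0
    show ?case by (simp add: psd_kernel_def)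
  next
    case (Suc N)
    then show ?case
      by (simp only: sum.lessThan_Suc)
        (intro psd_kernel_add psd_kernel_scale psd_kernel_power T q, auto)
  qed
  show "(\<lambda>N. \<Sum>n<N. complex_of_real (1 / fact n) * q g h ^ n) \<longlonglongrightarrow> exp (q g h)" for g h
    using exp_converges [of "q g h"] unfolding sums_def
    by (simp add: scaleR_conv_of_real divide_inverse)
qed

section \<open>Functionals and operators prescribed on a total family\<close>

lemma cspan_range_sum:
  assumes "y \<in> cspan (range x)"
  obtains T a where "finite T" "y = (\<Sum>g\<in>T. a g *\<^sub>C x g)"
proof -
  from assms have "\<exists>T a. finite T \<and> y = (\<Sum>g\<in>T. a g *\<^sub>C x g)"
  proof (induction rule: complex_vector.span_induct_alt)
    case base
    show ?case by (rule exI [of _ "{}"]) simp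
  next
    case (step c v y)
    then obtain T a g where *: "finite T" "y = (\<Sum>g\<in>T. a g *\<^sub>C x g)" "v = x g" by blast
    \<comment> \<open>The index g may already lie in T, in which case its coefficients add; outside
      T the values of a are arbitrary and are masked by 0.\<close>
    define b where "b h = (if h = g then c else 0) + (if h \<in> T then a h else 0)" for h
    have "(\<Sum>h\<in>insert g T. b h *\<^sub>C x h)
        = (\<Sum>h\<in>insert g T. (if h = g then c *\<^sub>C x h else 0)) + (\<Sum>h\<in>insert g T. if h \<in> T then a h *\<^sub>C x h else 0)"
      by (auto simp: b_def scaleC_add_left complex_vector.scale_zero_left simp flip: sum.distrib intro!: sum.cong)
    also have "(\<Sum>h\<in>insert g T. (if h = g then c *\<^sub>C x h else 0)) = c *\<^sub>C x g"
      using *(1) by simp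
    also have "(\<Sum>h\<in>insert g T. if h \<in> T then a h *\<^sub>C x h else 0) = (\<Sum>h\<in>T. a h *\<^sub>C x h)"
      using *(1) by (intro sum.mono_neutral_cong_right) auto
    finally show ?case
      using * by (intro exI [of _ "insert g T"] exI [of _ b]) simp
  qed
  then show ?thesis using that by blast
qed

lemma cinner_le_total:
  fixes x :: "'i \<Rightarrow> 'a::complex_inner"
  assumes total: "closure (cspan (range x)) = UNIV"
    and le: "\<And>T a. finite T \<Longrightarrow> cmod (cinner w (\<Sum>g\<in>T. a g *\<^sub>C x g)) \<le> M * norm (\<Sum>g\<in>T. a g *\<^sub>C x g)"
  shows "cmod (cinner w y) \<le> M * norm y"
proof -
  have "closed {y. cmod (cinner w y) \<le> M * norm y}"
    by (intro closed_Collect_le continuous_intros linear_continuous_on bounded_linear_cinner_right)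
  moreover have "cspan (range x) \<subseteq> {y. cmod (cinner w y) \<le> M * norm y}"
    using le by (auto elim!: cspan_range_sum)
  ultimately have "closure (cspan (range x)) \<subseteq> {y. cmod (cinner w y) \<le> M * norm y}"
    by (rule closure_minimal [rotated])
  then show ?thesis using total by auto
qed

text \<open>The bound makes the sum of the \<open>a g * \<beta> g\<close> depend only on the vector
  with coefficients a, so a bounded functional arises on the span even if the \<open>x g\<close> are
  linearly dependent.\<close>

lemma Riesz_total:
  fixes x :: "'i \<Rightarrow> 'a::chilbert_space" and \<beta> :: "'i \<Rightarrow> complex"
  assumes total: "closure (cspan (range x)) = UNIV" and M: "M \<ge> 0"
    and bound: "\<And>T a. finite T \<Longrightarrow> cmod (\<Sum>g\<in>T. a g * \<beta> g) \<le> M * norm (\<Sum>g\<in>T. a g *\<^sub>C x g)"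
  shows "\<exists>w. norm w \<le> M \<and> (\<forall>g. cinner w (x g) = \<beta> g)"
proof -
  \<comment> \<open>R relates a vector to the values produced by all its representations; that there
    is only one value is derived from the bound.\<close>
  define R where "R y c \<longleftrightarrow> (\<exists>T a. finite T \<and> y = (\<Sum>g\<in>T. a g *\<^sub>C x g) \<and> c = (\<Sum>g\<in>T. a g * \<beta> g))" for y c
  have R_bound: "cmod c \<le> M * norm y" if "R y c" for y c
    using that bound by (auto simp: R_def)
  have R_add: "R (y + y') (c + c')" if "R y c" "R y' c'" for y y' c c'
  proof -
    obtain T a where 1: "finite T" "y = (\<Sum>g\<in>T. a g *\<^sub>C x g)" "c = (\<Sum>g\<in>T. a g * \<beta> g)"
      using \<open>R y c\<close> unfolding R_def by blast
    obtain T' a' where 2: "finite T'" "y' = (\<Sum>g\<in>T'. a' g *\<^sub>C x g)" "c' = (\<Sum>g\<in>T'. a' g * \<beta> g)"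
      using \<open>R y' c'\<close> unfolding R_def by blast
    define b where "b g = (if g \<in> T then a g else 0)" for g
    define b' where "b' g = (if g \<in> T' then a' g else 0)" for g
    have "y = (\<Sum>g\<in>T \<union> T'. b g *\<^sub>C x g)" "c = (\<Sum>g\<in>T \<union> T'. b g * \<beta> g)"
      "y' = (\<Sum>g\<in>T \<union> T'. b' g *\<^sub>C x g)" "c' = (\<Sum>g\<in>T \<union> T'. b' g * \<beta> g)"
      using 1(1) 2(1) unfolding 1(2,3) 2(2,3) b_def b'_def
      by (auto intro!: sum.mono_neutral_cong_left simp: complex_vector.scale_zero_left)
    then have "y + y' = (\<Sum>g\<in>T \<union> T'. (b g + b' g) *\<^sub>C x g)" "c + c' = (\<Sum>g\<in>T \<union> T'. (b g + b' g) * \<beta> g)"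
      by (simp_all add: scaleC_add_left distrib_right sum.distrib)
    then show ?thesis
      unfolding R_def using 1(1) 2(1) by (intro exI [of _ "T \<union> T'"] exI [of _ "\<lambda>g. b g + b' g"]) auto
  qed
  have R_scale: "R (k *\<^sub>C y) (k * c)" if "R y c" for k y c
  proof -
    obtain T a where "finite T" "y = (\<Sum>g\<in>T. a g *\<^sub>C x g)" "c = (\<Sum>g\<in>T. a g * \<beta> g)"
      using \<open>R y c\<close> unfolding R_def by blast
    then show ?thesis
      unfolding R_def
      by (intro exI [of _ T] exI [of _ "\<lambda>g. k * a g"])
        (simp add: complex_vector.scale_sum_right scaleC_scaleC sum_distrib_left mult.assoc)
  qed
  have R_unique: "c = c'" if "R y c" "R y c'" for y c c'
  proof -
    \<comment> \<open>The difference of the two values is a value at the zero vector, where the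
      bound leaves only 0.\<close>
    have "R (y + (- 1) *\<^sub>C y) (c + (- 1) * c')" using that by (intro R_add R_scale)
    from R_bound [OF this] show ?thesis by (simp add: scaleC_minus_one)
  qed
  have R_base: "R (x g) (\<beta> g)" for g
    unfolding R_def by (rule exI [of _ "{g}"], rule exI [of _ "\<lambda>_. 1"]) (simp add: scaleC_one)
  define S where "S = {y. \<exists>c. R y c}"
  define \<phi> where "\<phi> y = (THE c. R y c)" for y
  have \<phi>: "\<phi> y = c" if "R y c" for y c
    unfolding \<phi>_def using that R_unique by blast
  have R\<phi>: "R y (\<phi> y)" if "y \<in> S" for y
    using that \<phi> by (auto simp: S_def)
  have "csubspace S"
    unfolding complex_vector.subspace_def
  proof (intro conjI ballI allI)
    have "R 0 0" unfolding R_def by (rule exI [of _ "{}"]) simp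
    then show "0 \<in> S" by (auto simp: S_def)
  qed (use R_add R_scale in \<open>auto simp: S_def\<close>, blast+)
  then obtain w where w: "\<And>y. y \<in> S \<Longrightarrow> \<phi> y = cinner w y"
  proof (rule Riesz_csubspace)
    show "\<phi> (y + z) = \<phi> y + \<phi> z" if "y \<in> S" "z \<in> S" for y z
      using that by (intro \<phi> R_add R\<phi>)
    show "\<phi> (a *\<^sub>C y) = a * \<phi> y" if "y \<in> S" for a y
      using that by (intro \<phi> R_scale R\<phi>)
    show "cmod (\<phi> y) \<le> M * norm y" if "y \<in> S" for y
      using that by (intro R_bound R\<phi>)
  qed blast
  have "norm w \<le> M"
  proof (rule norm_le_cinner [OF cinner_le_total [OF total] M])
    fix T :: "'i set" and a :: "'i \<Rightarrow> complex"
    assume "finite T"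
    then have "R (\<Sum>g\<in>T. a g *\<^sub>C x g) (\<Sum>g\<in>T. a g * \<beta> g)"
      unfolding R_def by blast
    then show "cmod (cinner w (\<Sum>g\<in>T. a g *\<^sub>C x g)) \<le> M * norm (\<Sum>g\<in>T. a g *\<^sub>C x g)"
      using R_bound w \<phi> unfolding S_def by (metis mem_Collect_eq)
  qed
  moreover have "cinner w (x g) = \<beta> g" for g
    using R_base [of g] w [of "x g"] \<phi> unfolding S_def by (metis mem_Collect_eq)
  ultimately show ?thesis by blast
qed

text \<open>\<open>Riesz_total\<close> is applied twice: first to obtain \<open>w g\<close>, the
  future value of the adjoint of B at \<open>x g\<close>, and then, for each y, to obtain
  \<open>B y\<close> from its inner products with the \<open>x g\<close>, which must be those of y
  with the \<open>w g\<close>.\<close>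

lemma bounded_op_of_kernel:
  fixes x :: "'i \<Rightarrow> 'a::chilbert_space" and b :: "'i \<Rightarrow> 'i \<Rightarrow> complex"
  assumes total: "closure (cspan (range x)) = UNIV" and K: "K \<ge> 0"
    and bound: "\<And>T U a c. finite T \<Longrightarrow> finite U \<Longrightarrow>
      cmod (\<Sum>g\<in>T. \<Sum>h\<in>U. cnj (a g) * c h * b g h)
        \<le> K * norm (\<Sum>g\<in>T. a g *\<^sub>C x g) * norm (\<Sum>h\<in>U. c h *\<^sub>C x h)"
  shows "\<exists>B. bounded_op B \<and> (\<forall>g h. cinner (x g) (B (x h)) = b g h) \<and> (\<forall>y. norm (B y) \<le> K * norm y)"
proof -
  have "\<exists>w. norm w \<le> K * norm (x g) \<and> (\<forall>h. cinner w (x h) = b g h)" for g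
  proof (rule Riesz_total [OF total])
    show "cmod (\<Sum>h\<in>U. c h * b g h) \<le> K * norm (x g) * norm (\<Sum>h\<in>U. c h *\<^sub>C x h)"
      if "finite U" for U c
      using bound [of "{g}" U "\<lambda>_. 1" c] that by (simp add: scaleC_one)
  qed (use K in simp)
  then obtain w where w: "\<And>g h. cinner (w g) (x h) = b g h" by metis
  have w_bound: "norm (\<Sum>g\<in>T. a g *\<^sub>C w g) \<le> K * norm (\<Sum>g\<in>T. a g *\<^sub>C x g)" if "finite T" for T a
  proof (rule norm_le_cinner [OF cinner_le_total [OF total]])
    fix U :: "'i set" and c :: "'i \<Rightarrow> complex"
    assume "finite U"
    have "cinner (\<Sum>g\<in>T. a g *\<^sub>C w g) (\<Sum>h\<in>U. c h *\<^sub>C x h) = (\<Sum>g\<in>T. \<Sum>h\<in>U. cnj (a g) * c h * b g h)"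
      unfolding cinner_sum_left unfolding cinner_sum_right
      by (simp add: cinner_scaleC_left cinner_scaleC_right w mult_ac)
    then show "cmod (cinner (\<Sum>g\<in>T. a g *\<^sub>C w g) (\<Sum>h\<in>U. c h *\<^sub>C x h))
        \<le> K * norm (\<Sum>g\<in>T. a g *\<^sub>C x g) * norm (\<Sum>h\<in>U. c h *\<^sub>C x h)"
      using bound [OF \<open>finite T\<close> \<open>finite U\<close>] by simp
  qed (use K in simp)
  have "\<exists>v. norm v \<le> K * norm y \<and> (\<forall>g. cinner v (x g) = cinner y (w g))" for y
  proof (rule Riesz_total [OF total])
    fix T :: "'i set" and a :: "'i \<Rightarrow> complex"
    assume T: "finite T"
    have "(\<Sum>g\<in>T. a g * cinner y (w g)) = cinner y (\<Sum>g\<in>T. a g *\<^sub>C w g)"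
      by (simp add: cinner_sum_right cinner_scaleC_right)
    also have "cmod \<dots> \<le> norm y * norm (\<Sum>g\<in>T. a g *\<^sub>C w g)"
      by (rule cinner_Cauchy_Schwarz)
    also have "\<dots> \<le> norm y * (K * norm (\<Sum>g\<in>T. a g *\<^sub>C x g))"
      by (intro mult_left_mono w_bound T) simp
    finally show "cmod (\<Sum>g\<in>T. a g * cinner y (w g)) \<le> K * norm y * norm (\<Sum>g\<in>T. a g *\<^sub>C x g)"
      by (simp add: mult_ac)
  qed (use K in simp)
  then obtain B where B: "\<And>y. norm (B y) \<le> K * norm y" "\<And>y g. cinner (B y) (x g) = cinner y (w g)"
    by metis
  have B': "cinner (x g) (B y) = cinner (w g) y" for g y
    by (metis B(2) cinner_commute)
  have "bounded_op B"
  proof (rule bounded_opI [OF _ _ B(1)])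
    show "B (y + z) = B y + B z" for y z
      by (rule cinner_total_eq_I [OF total]) (auto simp: B' cinner_add_right)
    show "B (a *\<^sub>C y) = a *\<^sub>C B y" for a y
      by (rule cinner_total_eq_I [OF total]) (auto simp: B' cinner_scaleC_right)
  qed
  then show ?thesis using B B' w by metis
qed

section \<open>Second quantization of a contraction\<close>

lemma bounded_bilinear_cinner: "bounded_bilinear cinner"
proof (intro bounded_bilinear.intro exI allI)
  show "cmod (cinner x y) \<le> norm x * norm y * 1" for x y
    using cinner_Cauchy_Schwarz by simp
qed (simp_all add: cinner_add_left cinner_add_right scaleR_eq_scaleC cinner_scaleC_left
    cinner_scaleC_right scaleR_conv_of_real)

lemma scaleC_fun_apply: "(a *\<^sub>C f) x = a *\<^sub>C f x"
  by (simp add: scaleC_fun_def)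

lemma cinner_sum_scaleC:
  "cinner (\<Sum>g\<in>T. a g *\<^sub>C v g) (\<Sum>h\<in>U. c h *\<^sub>C w h)
    = (\<Sum>g\<in>T. \<Sum>h\<in>U. cnj (a g) * c h * cinner (v g) (w h))"
  unfolding cinner_sum_left unfolding cinner_sum_right
  by (simp add: cinner_scaleC_left cinner_scaleC_right mult_ac)

lemma strongly_tendsto_unique:
  assumes "strongly_tendsto X A" "strongly_tendsto X B" shows "A = B"
proof (rule ext)
  show "A x = B x" for x
    using assms unfolding strongly_tendsto_def by (intro LIMSEQ_unique [of "\<lambda>n. X n x"]) auto
qed

section \<open>The defect kernel of the contraction\<close>

text \<open>D is the adjoint of C, kept as a parameter because \<open>cadjoint\<close> is defined
  only for operators on a single space.\<close>

locale second_quantization =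
  V1: cyclic_vacuum W1 \<Omega>1 + V2: cyclic_vacuum W2 \<Omega>2
  for W1 :: "'k1::chilbert_space \<Rightarrow> 'h1::chilbert_space \<Rightarrow> 'h1" and \<Omega>1
    and W2 :: "'k2::chilbert_space \<Rightarrow> 'h2::chilbert_space \<Rightarrow> 'h2" and \<Omega>2 +
  fixes C :: "'k1 \<Rightarrow> 'k2" and D :: "'k2 \<Rightarrow> 'k1"
  assumes D_bounded: "bounded_op D"
    and D_adjoint: "cinner (D g) f = cinner g (C f)"
    and D_contraction: "norm (D g) \<le> norm g"
begin

text \<open>This is \<langle>g, (1 - C D) h\<rangle>, the form of a positive operator.\<close>

definition defect :: "'k2 \<Rightarrow> 'k2 \<Rightarrow> complex" where
  "defect g h = cinner g h - cinner (D g) (D h)"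

text \<open>Compare \<open>cinner_coherent\<close>: this is the inner product of coherent vectors
  with the defect form in place of the inner product.\<close>

definition kernel :: "'k2 \<Rightarrow> 'k2 \<Rightarrow> complex" where
  "kernel g h = exp (defect g h - (defect g g + defect h h) / 2)"

text \<open>For the combination u of the vectors g, the quadratic form equals the difference of the
  squared norms of u and \<open>D u\<close>.\<close>

lemma psd_kernel_defect: "psd_kernel T defect"
  unfolding psd_kernel_def
proof (intro conjI ballI allI)
  show "defect h g = cnj (defect g h)" for g h
    unfolding defect_def by (metis cinner_commute complex_cnj_diff)
  fix a :: "'k2 \<Rightarrow> complex"
  define u where "u = (\<Sum>g\<in>T. a g *\<^sub>C g)"
  have Du: "D u = (\<Sum>g\<in>T. a g *\<^sub>C D g)"
    by (simp add: u_def bounded_op_sum [OF D_bounded] bounded_op_scaleC [OF D_bounded])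
  have "(\<Sum>g\<in>T. \<Sum>h\<in>T. cnj (a g) * a h * defect g h) = cinner u u - cinner (D u) (D u)"
    unfolding Du unfolding u_def defect_def cinner_sum_scaleC
    by (simp add: right_diff_distrib sum_subtractf)
  also have "\<dots> = complex_of_real ((norm u)\<^sup>2 - (norm (D u))\<^sup>2)"
    by (simp add: cinner_self)
  finally show "0 \<le> Re (\<Sum>g\<in>T. \<Sum>h\<in>T. cnj (a g) * a h * defect g h)"
    using D_contraction [of u] by (simp add: power_mono)
qed

lemma defect_self: "cnj (defect g g) = defect g g"
  by (simp add: defect_def cinner_self)

lemma psd_kernel_kernel:
  assumes "finite T" shows "psd_kernel T kernel"
proof -
  \<comment> \<open>As the diagonal of \<open>defect\<close> is real, the normalization of
    \<open>kernel\<close> is a factor of rank one.\<close>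
  define c where "c g = exp (- (defect g g / 2))" for g
  have "cnj (c g) = c g" for g
    by (simp add: c_def exp_cnj defect_self)
  then have "kernel g h = cnj (c g) * c h * exp (defect g h)" for g h
    by (simp add: kernel_def c_def add_divide_distrib algebra_simps flip: exp_add)
  then have "kernel = (\<lambda>g h. cnj (c g) * c h * exp (defect g h))" by blast
  then show ?thesis
    using psd_kernel_mult [OF assms psd_kernel_conj psd_kernel_exp [OF assms psd_kernel_defect]] by simp
qed

lemma kernel_self [simp]: "kernel g g = 1"
  by (simp add: kernel_def)

text \<open>The prospective matrix elements of \<Gamma>(A) between coherent vectors. They are
  meaningful for every operator A, so \<Gamma> is defined at once on all bounded operators instead
  of being extended from the span.\<close>

definition form :: "('h1 \<Rightarrow> 'h1) \<Rightarrow> 'k2 \<Rightarrow> 'k2 \<Rightarrow> complex" where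
  "form A g h = kernel g h * cinner (W1 (D g) \<Omega>1) (A (W1 (D h) \<Omega>1))"

text \<open>Both sides are explicit exponentials. The kernel replaces \<langle>D g, D h\<rangle> by
  \<langle>g, h\<rangle>, likewise for the squared norms, and adjointness turns D into C in the
  terms containing f.\<close>

lemma form_W1:
  "form (W1 f) g h = complex_of_real (exp (- (1/2) * ((norm f)\<^sup>2 - (norm (C f))\<^sup>2)))
    * cinner (W2 g \<Omega>2) (W2 (C f) (W2 h \<Omega>2))"
proof -
  have CD: "cinner f (D h) = cinner (C f) h"
    by (metis D_adjoint cinner_commute)
  show ?thesis
    unfolding form_def V1.cinner_W_coherent V2.cinner_W_coherent kernel_def defect_def
      exp_of_real [symmetric] exp_add [symmetric]
    by (rule arg_cong [where f = exp])
      (simp add: cinner_self CD D_adjoint diff_divide_distrib add_divide_distrib algebra_simps)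
qed

lemma C_zero: "C 0 = 0"
  by (rule cinner_eq_I) (metis D_adjoint cinner_zero_right)

lemma form_id: "form id g h = cinner (W2 g \<Omega>2) (W2 h \<Omega>2)"
  using form_W1 [of 0 g h] by (simp add: C_zero V1.W_zero V2.W_zero)

section \<open>Gram factorization of the form and the resulting estimates\<close>

text \<open>The Gram factor M sends the combination of coherent vectors with coefficients a to a
  tuple of vectors indexed by r, and A acts on each entry: the form of 1 \<otimes> A in
  coordinates.\<close>

lemma gram_decomposition:
  assumes M: "\<And>g h. g \<in> R \<Longrightarrow> h \<in> R \<Longrightarrow> kernel g h = (\<Sum>r\<in>R. cnj (M r g) * M r h)"
    and "T \<subseteq> R" "U \<subseteq> R" and A: "bounded_op A"
  shows "(\<Sum>g\<in>T. \<Sum>h\<in>U. cnj (a g) * c h * form A g h)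
    = (\<Sum>r\<in>R. cinner (\<Sum>g\<in>T. (a g * M r g) *\<^sub>C W1 (D g) \<Omega>1)
        (A (\<Sum>h\<in>U. (c h * M r h) *\<^sub>C W1 (D h) \<Omega>1)))"
proof -
  define y where "y g = W1 (D g) \<Omega>1" for g
  have "(\<Sum>g\<in>T. \<Sum>h\<in>U. cnj (a g) * c h * form A g h)
      = (\<Sum>g\<in>T. \<Sum>h\<in>U. \<Sum>r\<in>R. cnj (a g * M r g) * (c h * M r h) * cinner (y g) (A (y h)))"
  proof (intro sum.cong refl)
    fix g h assume "g \<in> T" "h \<in> U"
    then have "kernel g h = (\<Sum>r\<in>R. cnj (M r g) * M r h)" using assms(2,3) by (intro M) auto
    then show "cnj (a g) * c h * form A g h
        = (\<Sum>r\<in>R. cnj (a g * M r g) * (c h * M r h) * cinner (y g) (A (y h)))"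
      by (simp add: form_def y_def sum_distrib_left sum_distrib_right mult_ac)
  qed
  also have "\<dots> = (\<Sum>g\<in>T. \<Sum>r\<in>R. \<Sum>h\<in>U. cnj (a g * M r g) * (c h * M r h) * cinner (y g) (A (y h)))"
    by (intro sum.cong refl sum.swap)
  also have "\<dots> = (\<Sum>r\<in>R. \<Sum>g\<in>T. \<Sum>h\<in>U. cnj (a g * M r g) * (c h * M r h) * cinner (y g) (A (y h)))"
    by (rule sum.swap)
  also have "\<dots> = (\<Sum>r\<in>R. cinner (\<Sum>g\<in>T. (a g * M r g) *\<^sub>C y g) (A (\<Sum>h\<in>U. (c h * M r h) *\<^sub>C y h)))"
    unfolding cinner_sum_left bounded_op_sum [OF A] unfolding cinner_sum_right
    by (simp add: cinner_scaleC_left cinner_scaleC_right bounded_op_scaleC [OF A] mult_ac)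
  finally show ?thesis by (simp only: y_def)
qed

text \<open>The first claim is Cauchy-Schwarz for each r and then over r. The second says that
  passing to tuples is isometric; it is the decomposition for A = id, where \<open>form_id\<close>
  gives the inner product.\<close>

lemma form_estimate:
  assumes "finite R" "T \<subseteq> R" "U \<subseteq> R" and A: "bounded_op A"
    and M: "\<And>g h. g \<in> R \<Longrightarrow> h \<in> R \<Longrightarrow> kernel g h = (\<Sum>r\<in>R. cnj (M r g) * M r h)"
  shows "cmod (\<Sum>g\<in>T. \<Sum>h\<in>U. cnj (a g) * c h * form A g h)
    \<le> norm (\<Sum>g\<in>T. a g *\<^sub>C W2 g \<Omega>2)
      * L2_set (\<lambda>r. norm (A (\<Sum>h\<in>U. (c h * M r h) *\<^sub>C W1 (D h) \<Omega>1))) R"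
    and "L2_set (\<lambda>r. norm (\<Sum>g\<in>T. (a g * M r g) *\<^sub>C W1 (D g) \<Omega>1)) R
      = norm (\<Sum>g\<in>T. a g *\<^sub>C W2 g \<Omega>2)"
proof -
  define X where "X r = (\<Sum>g\<in>T. (a g * M r g) *\<^sub>C W1 (D g) \<Omega>1)" for r
  define Y where "Y r = A (\<Sum>h\<in>U. (c h * M r h) *\<^sub>C W1 (D h) \<Omega>1)" for r
  have "complex_of_real (\<Sum>r\<in>R. (norm (X r))\<^sup>2) = (\<Sum>r\<in>R. cinner (X r) (id (X r)))"
    by (simp add: cinner_self)
  also have "\<dots> = (\<Sum>g\<in>T. \<Sum>h\<in>T. cnj (a g) * a h * form id g h)"
    unfolding X_def by (rule gram_decomposition [OF M assms(2,2) bounded_op_id, symmetric])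
  also have "\<dots> = cinner (\<Sum>g\<in>T. a g *\<^sub>C W2 g \<Omega>2) (\<Sum>g\<in>T. a g *\<^sub>C W2 g \<Omega>2)"
    unfolding cinner_sum_scaleC form_id ..
  also have "\<dots> = complex_of_real ((norm (\<Sum>g\<in>T. a g *\<^sub>C W2 g \<Omega>2))\<^sup>2)"
    by (rule cinner_self)
  finally have "(\<Sum>r\<in>R. (norm (X r))\<^sup>2) = (norm (\<Sum>g\<in>T. a g *\<^sub>C W2 g \<Omega>2))\<^sup>2"
    by (simp only: of_real_eq_iff)
  then have L2: "L2_set (\<lambda>r. norm (X r)) R = norm (\<Sum>g\<in>T. a g *\<^sub>C W2 g \<Omega>2)"
    by (simp add: L2_set_def)
  have "cmod (\<Sum>g\<in>T. \<Sum>h\<in>U. cnj (a g) * c h * form A g h) = cmod (\<Sum>r\<in>R. cinner (X r) (Y r))"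
    using gram_decomposition [OF M assms(2,3) A] by (simp add: X_def Y_def)
  also have "\<dots> \<le> (\<Sum>r\<in>R. \<bar>norm (X r)\<bar> * \<bar>norm (Y r)\<bar>)"
    by (intro sum_norm_le) (simp add: cinner_Cauchy_Schwarz)
  also have "\<dots> \<le> L2_set (\<lambda>r. norm (X r)) R * L2_set (\<lambda>r. norm (Y r)) R"
    by (rule L2_set_mult_ineq)
  finally show "cmod (\<Sum>g\<in>T. \<Sum>h\<in>U. cnj (a g) * c h * form A g h)
    \<le> norm (\<Sum>g\<in>T. a g *\<^sub>C W2 g \<Omega>2)
      * L2_set (\<lambda>r. norm (A (\<Sum>h\<in>U. (c h * M r h) *\<^sub>C W1 (D h) \<Omega>1))) R"
    by (simp add: L2 Y_def)
  show "L2_set (\<lambda>r. norm (\<Sum>g\<in>T. (a g * M r g) *\<^sub>C W1 (D g) \<Omega>1)) R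
      = norm (\<Sum>g\<in>T. a g *\<^sub>C W2 g \<Omega>2)"
    using L2 by (simp add: X_def)
qed

lemma kernel_gram:
  assumes "finite R"
  obtains M where "\<And>g h. g \<in> R \<Longrightarrow> h \<in> R \<Longrightarrow> kernel g h = (\<Sum>r\<in>R. cnj (M r g) * M r h)"
  using psd_kernel_gram [OF assms psd_kernel_kernel [OF assms]] by blast

lemma form_bound:
  assumes A: "bounded_op A" and K: "K \<ge> 0" "\<And>x. norm (A x) \<le> K * norm x"
    and "finite T" "finite U"
  shows "cmod (\<Sum>g\<in>T. \<Sum>h\<in>U. cnj (a g) * c h * form A g h)
    \<le> K * norm (\<Sum>g\<in>T. a g *\<^sub>C W2 g \<Omega>2) * norm (\<Sum>h\<in>U. c h *\<^sub>C W2 h \<Omega>2)"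
proof -
  have R: "finite (T \<union> U)" using assms by simp
  obtain M where M: "\<And>g h. g \<in> T \<union> U \<Longrightarrow> h \<in> T \<union> U \<Longrightarrow> kernel g h = (\<Sum>r\<in>T \<union> U. cnj (M r g) * M r h)"
    using kernel_gram [OF R] by blast
  note est = form_estimate [OF R _ _ _ M]
  have "cmod (\<Sum>g\<in>T. \<Sum>h\<in>U. cnj (a g) * c h * form A g h)
    \<le> norm (\<Sum>g\<in>T. a g *\<^sub>C W2 g \<Omega>2)
      * L2_set (\<lambda>r. norm (A (\<Sum>h\<in>U. (c h * M r h) *\<^sub>C W1 (D h) \<Omega>1))) (T \<union> U)"
    by (rule est(1)) (use A in auto)
  also have "\<dots> \<le> norm (\<Sum>g\<in>T. a g *\<^sub>C W2 g \<Omega>2)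
      * L2_set (\<lambda>r. K * norm (\<Sum>h\<in>U. (c h * M r h) *\<^sub>C W1 (D h) \<Omega>1)) (T \<union> U)"
    by (intro mult_left_mono L2_set_mono K) auto
  also have "L2_set (\<lambda>r. K * norm (\<Sum>h\<in>U. (c h * M r h) *\<^sub>C W1 (D h) \<Omega>1)) (T \<union> U)
      = K * norm (\<Sum>h\<in>U. c h *\<^sub>C W2 h \<Omega>2)"
    unfolding L2_set_right_distrib [OF K(1), symmetric] by (subst est(2)) (use A in auto)
  finally show ?thesis by (simp add: mult_ac)
qed

text \<open>A single coherent vector corresponds to the tensor product of column h of M with
  \<open>W1 (D h) \<Omega>1\<close>, and this column has norm 1 because
  \<open>kernel h h = 1\<close>. Only the value of A at one vector enters, which is what strong
  continuity needs.\<close>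

lemma form_bound_coherent:
  assumes A: "bounded_op A" and T: "finite T"
  shows "cmod (\<Sum>g\<in>T. cnj (a g) * form A g h) \<le> norm (\<Sum>g\<in>T. a g *\<^sub>C W2 g \<Omega>2) * norm (A (W1 (D h) \<Omega>1))"
proof -
  have R: "finite (insert h T)" using T by simp
  obtain M where M: "\<And>g k. g \<in> insert h T \<Longrightarrow> k \<in> insert h T
      \<Longrightarrow> kernel g k = (\<Sum>r\<in>insert h T. cnj (M r g) * M r k)"
    using kernel_gram [OF R] by blast
  have "complex_of_real (\<Sum>r\<in>insert h T. (cmod (M r h))\<^sup>2) = (\<Sum>r\<in>insert h T. cnj (M r h) * M r h)"
    unfolding of_real_sum by (intro sum.cong) (simp_all only: complex_norm_square mult.commute)
  also have "\<dots> = complex_of_real 1"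
    using M [of h h] by simp
  finally have "(\<Sum>r\<in>insert h T. (cmod (M r h))\<^sup>2) = 1"
    by (simp only: of_real_eq_iff)
  then have L2: "L2_set (\<lambda>r. cmod (M r h)) (insert h T) = 1"
    by (simp add: L2_set_def)
  have "cmod (\<Sum>g\<in>T. \<Sum>k\<in>{h}. cnj (a g) * 1 * form A g k)
    \<le> norm (\<Sum>g\<in>T. a g *\<^sub>C W2 g \<Omega>2)
      * L2_set (\<lambda>r. norm (A (\<Sum>k\<in>{h}. (1 * M r k) *\<^sub>C W1 (D k) \<Omega>1))) (insert h T)"
    by (rule form_estimate(1) [OF R _ _ A M]) auto
  also have "L2_set (\<lambda>r. norm (A (\<Sum>k\<in>{h}. (1 * M r k) *\<^sub>C W1 (D k) \<Omega>1))) (insert h T)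
      = L2_set (\<lambda>r. cmod (M r h)) (insert h T) * norm (A (W1 (D h) \<Omega>1))"
    by (simp add: bounded_op_scaleC [OF A] norm_scaleC L2_set_left_distrib)
  finally show ?thesis by (simp add: L2)
qed

section \<open>The map \<Gamma> and its strong continuity\<close>

text \<open>Coherent vectors are total, so at most one bounded operator has these matrix elements;
  for bounded A its existence is \<open>gamma_exists\<close>.\<close>

definition gamma :: "('h1 \<Rightarrow> 'h1) \<Rightarrow> 'h2 \<Rightarrow> 'h2" where
  "gamma A = (THE B. bounded_op B \<and> (\<forall>g h. cinner (W2 g \<Omega>2) (B (W2 h \<Omega>2)) = form A g h))"

lemma gamma_eq_I:
  assumes B: "bounded_op B" "\<And>g h. cinner (W2 g \<Omega>2) (B (W2 h \<Omega>2)) = form A g h"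
  shows "gamma A = B"
  unfolding gamma_def
proof (rule the_equality)
  fix B' assume B': "bounded_op B' \<and> (\<forall>g h. cinner (W2 g \<Omega>2) (B' (W2 h \<Omega>2)) = form A g h)"
  show "B' = B"
  proof (rule bounded_op_total_eq_I [OF V2.total])
    fix s assume "s \<in> range (\<lambda>f. W2 f \<Omega>2)"
    then show "B' s = B s"
      using B B' by (intro cinner_total_eq_I [OF V2.total]) auto
  qed (use B B' in auto)
qed (use B in auto)

text \<open>The constant K of A is inherited, so uniform bounds of sequences pass to their
  images.\<close>

lemma gamma_exists:
  assumes A: "bounded_op A" and K: "K \<ge> 0" "\<And>x. norm (A x) \<le> K * norm x"
  shows "bounded_op (gamma A) \<and> (\<forall>g h. cinner (W2 g \<Omega>2) (gamma A (W2 h \<Omega>2)) = form A g h)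
    \<and> (\<forall>y. norm (gamma A y) \<le> K * norm y)"
  using bounded_op_of_kernel [OF V2.total K(1) form_bound [OF A K]] gamma_eq_I by metis

lemma bounded_op_gamma: "bounded_op A \<Longrightarrow> bounded_op (gamma A)"
  and cinner_gamma: "bounded_op A \<Longrightarrow> cinner (W2 g \<Omega>2) (gamma A (W2 h \<Omega>2)) = form A g h"
  using gamma_exists bounded_op_bound by metis+

lemma gamma_W1:
  "gamma (W1 f) = complex_of_real (exp (- (1/2) * ((norm f)\<^sup>2 - (norm (C f))\<^sup>2))) *\<^sub>C W2 (C f)"
  by (rule gamma_eq_I)
    (simp_all only: bounded_op_scale V2.W_bounded scaleC_fun_apply cinner_scaleC_right form_W1)

lemma gamma_id: "gamma id = id"
  by (rule gamma_eq_I) (simp_all add: bounded_op_id form_id)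

lemma gamma_plus: "bounded_op A \<Longrightarrow> bounded_op B \<Longrightarrow> gamma (A + B) = gamma A + gamma B"
  by (rule gamma_eq_I)
    (simp_all add: bounded_op_plus bounded_op_gamma cinner_add_right cinner_gamma form_def distrib_left)

lemma gamma_scaleC: "bounded_op A \<Longrightarrow> gamma (a *\<^sub>C A) = a *\<^sub>C gamma A"
  by (rule gamma_eq_I)
    (simp_all add: bounded_op_scale bounded_op_gamma scaleC_fun_apply cinner_scaleC_right
      cinner_gamma form_def)

text \<open>
  Applied to \<open>A = X n - X\<close>, this Kadison--Schwarz type bound turns strong convergence of operators
  into strong convergence of their images.
\<close>

lemma norm_gamma_coherent:
  assumes A: "bounded_op A"
  shows "norm (gamma A (W2 h \<Omega>2)) \<le> norm (A (W1 (D h) \<Omega>1))"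
proof (rule norm_le_cinner [OF cinner_le_total [OF V2.total]])
  fix T :: "'k2 set" and a :: "'k2 \<Rightarrow> complex"
  assume T: "finite T"
  have "cinner (\<Sum>g\<in>T. a g *\<^sub>C W2 g \<Omega>2) (gamma A (W2 h \<Omega>2)) = (\<Sum>g\<in>T. cnj (a g) * form A g h)"
    by (simp add: cinner_sum_left cinner_scaleC_left cinner_gamma A)
  then have "cmod (cinner (\<Sum>g\<in>T. a g *\<^sub>C W2 g \<Omega>2) (gamma A (W2 h \<Omega>2)))
      \<le> norm (\<Sum>g\<in>T. a g *\<^sub>C W2 g \<Omega>2) * norm (A (W1 (D h) \<Omega>1))"
    using form_bound_coherent [OF A T] by simp
  then show "cmod (cinner (gamma A (W2 h \<Omega>2)) (\<Sum>g\<in>T. a g *\<^sub>C W2 g \<Omega>2))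
      \<le> norm (A (W1 (D h) \<Omega>1)) * norm (\<Sum>g\<in>T. a g *\<^sub>C W2 g \<Omega>2)"
    by (subst cinner_commute) (simp only: complex_mod_cnj mult.commute)
qed simp

text \<open>On coherent vectors convergence follows from \<open>norm_gamma_coherent\<close>; the
  common bound M, inherited by the images, extends it to all vectors.\<close>

lemma strongly_tendsto_gamma:
  assumes X: "\<And>n. bounded_op (X n)" and A: "bounded_op A" and lim: "strongly_tendsto X A"
  shows "strongly_tendsto (\<lambda>n. gamma (X n)) (gamma A)"
proof -
  obtain M where M: "M \<ge> 0" "\<And>n x. norm (X n x) \<le> M * norm x"
    using strongly_tendsto_bound [OF X lim] by blast
  have bG: "bounded_op (gamma (X n))" for n by (rule bounded_op_gamma [OF X])
  have cl: "closed {x. (\<lambda>n. gamma (X n) x) \<longlonglongrightarrow> gamma A x}"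
    using gamma_exists [OF X M] by (intro closed_convergence [OF bG M(1) _ bounded_op_gamma [OF A]]) blast
  show ?thesis
    unfolding strongly_tendsto_def
  proof (intro allI, rule total_induct [OF V2.total, where P = "\<lambda>x. (\<lambda>n. gamma (X n) x) \<longlonglongrightarrow> gamma A x"])
    fix s assume "s \<in> range (\<lambda>f. W2 f \<Omega>2)"
    then obtain h where s: "s = W2 h \<Omega>2" by blast
    define y where "y = W1 (D h) \<Omega>1"
    have le: "norm (gamma (X n) s - gamma A s) \<le> norm (X n y - A y)" for n
    proof -
      have b: "bounded_op (X n + (- 1) *\<^sub>C A)" by (intro bounded_op_plus bounded_op_scale X A)
      have "gamma (X n + (- 1) *\<^sub>C A) = gamma (X n) + (- 1) *\<^sub>C gamma A"
        by (simp only: gamma_plus gamma_scaleC X A bounded_op_scale)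
      then show ?thesis
        using norm_gamma_coherent [OF b, of h]
        by (simp add: s y_def scaleC_fun_apply scaleC_minus_one)
    qed
    have "(\<lambda>n. X n y) \<longlonglongrightarrow> A y" using lim by (simp add: strongly_tendsto_def)
    then have "(\<lambda>n. norm (X n y - A y)) \<longlonglongrightarrow> 0"
      by (simp add: tendsto_norm_zero_iff LIM_zero_iff)
    then have "(\<lambda>n. gamma (X n) s - gamma A s) \<longlonglongrightarrow> 0"
      by (rule Lim_null_comparison [rotated]) (simp add: le)
    then show "(\<lambda>n. gamma (X n) s) \<longlonglongrightarrow> gamma A s"
      by (simp add: LIM_zero_iff)
  qed (intro csubspace_convergence bG bounded_op_gamma A cl)+
qed

lemma gamma_weyl_span:
  assumes "A \<in> weyl_span W1" shows "gamma A \<in> weyl_span W2"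
proof -
  note sub = V2.csubspace_weyl_span
  \<comment> \<open>Boundedness is carried along because additivity and homogeneity of
    \<open>gamma\<close> are available for bounded operators.\<close>
  have "bounded_op A \<and> gamma A \<in> weyl_span W2"
    using assms
  proof (induction rule: V1.weyl_span_induct)
    case (W f)
    show ?case
      unfolding gamma_W1
      by (intro conjI V1.W_bounded complex_vector.subspace_scale [OF sub] V2.W_in_weyl_span)
  next
    case subspace
    have "gamma 0 = 0"
      by (rule gamma_eq_I) (simp_all add: bounded_op_zero form_def)
    then show ?case
      unfolding complex_vector.subspace_def
      using complex_vector.subspace_0 [OF sub] complex_vector.subspace_add [OF sub]
        complex_vector.subspace_scale [OF sub]
      by (simp add: bounded_op_zero bounded_op_plus bounded_op_scale gamma_plus gamma_scaleC)
  qed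
  then show ?thesis by blast
qed

lemma gamma_weyl_algebra:
  assumes "A \<in> weyl_algebra W1" shows "gamma A \<in> weyl_algebra W2"
  using assms unfolding V1.weyl_algebra_eq_strong_closure V2.weyl_algebra_eq_strong_closure
proof (induction rule: strong_closure_induct)
  case (base A)
  then show ?case by (intro strong_closure.base gamma_weyl_span)
next
  case (limit X A)
  have bX: "bounded_op (X n)" for n
    using limit.hyps(1) by (rule V1.strong_closure_weyl_bounded)
  show ?case
    by (rule strong_closure.limit [OF _ bounded_op_gamma [OF limit.hyps(2)]
          strongly_tendsto_gamma [OF bX limit.hyps(2,3)]]) (use limit.IH in blast)
qed

section \<open>Complete positivity and preservation of the vacuum state\<close>

text \<open>On the span, the form of the image matrix at \<xi> is the sum over r of the forms of A
  at the tuples \<open>X r\<close>, each nonnegative by assumption; the general case follows by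
  approximation.\<close>

lemma gamma_completely_positive:
  assumes A: "\<And>i j. i < n \<Longrightarrow> j < n \<Longrightarrow> bounded_op (A i j)" and pos: "positive_op_matrix n A"
  shows "positive_op_matrix n (\<lambda>i j. gamma (A i j))"
proof -
  define S where "S = cspan (range (\<lambda>f. W2 f \<Omega>2))"
  have on_span: "(\<Sum>i<n. cinner (\<xi> i) (\<Sum>j<n. gamma (A i j) (\<xi> j))) \<in> \<real>\<^sub>\<ge>\<^sub>0" if \<xi>: "\<And>i. \<xi> i \<in> S" for \<xi>
  proof -
    have "\<exists>T a. finite T \<and> \<xi> i = (\<Sum>g\<in>T. a g *\<^sub>C W2 g \<Omega>2)" for i
      using cspan_range_sum \<xi> unfolding S_def by metis
    then obtain T a where T: "\<And>i. finite (T i)" and \<xi>_eq: "\<And>i. \<xi> i = (\<Sum>g\<in>T i. a i g *\<^sub>C W2 g \<Omega>2)"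
      by metis
    \<comment> \<open>One finite index set for all components, so that a single Gram factor serves
      every pair i, j.\<close>
    define R where "R = (\<Union>i<n. T i)"
    have R: "finite R" and TR: "\<And>i. i < n \<Longrightarrow> T i \<subseteq> R" using T by (auto simp: R_def)
    obtain M where M: "\<And>g h. g \<in> R \<Longrightarrow> h \<in> R \<Longrightarrow> kernel g h = (\<Sum>r\<in>R. cnj (M r g) * M r h)"
      using kernel_gram [OF R] by blast
    define X where "X r i = (\<Sum>g\<in>T i. (a i g * M r g) *\<^sub>C W1 (D g) \<Omega>1)" for r i
    have "cinner (\<xi> i) (gamma (A i j) (\<xi> j)) = (\<Sum>r\<in>R. cinner (X r i) (A i j (X r j)))"
      if "i < n" "j < n" for i j
    proof -
      have "cinner (\<xi> i) (gamma (A i j) (\<xi> j))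
          = (\<Sum>g\<in>T i. \<Sum>h\<in>T j. cnj (a i g) * a j h * form (A i j) g h)"
        unfolding \<xi>_eq bounded_op_sum [OF bounded_op_gamma [OF A [OF that]]] cinner_sum_left
        unfolding cinner_sum_right
        by (simp add: bounded_op_scaleC [OF bounded_op_gamma [OF A [OF that]]] cinner_scaleC_left
            cinner_scaleC_right cinner_gamma [OF A [OF that]] mult_ac)
      also have "\<dots> = (\<Sum>r\<in>R. cinner (X r i) (A i j (X r j)))"
        unfolding X_def using that by (intro gram_decomposition M TR A)
      finally show ?thesis .
    qed
    then have "(\<Sum>i<n. cinner (\<xi> i) (\<Sum>j<n. gamma (A i j) (\<xi> j)))
        = (\<Sum>i<n. \<Sum>j<n. \<Sum>r\<in>R. cinner (X r i) (A i j (X r j)))"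
      by (simp add: cinner_sum_right)
    also have "\<dots> = (\<Sum>i<n. \<Sum>r\<in>R. \<Sum>j<n. cinner (X r i) (A i j (X r j)))"
      by (intro sum.cong refl sum.swap)
    also have "\<dots> = (\<Sum>r\<in>R. \<Sum>i<n. \<Sum>j<n. cinner (X r i) (A i j (X r j)))"
      by (rule sum.swap)
    also have "\<dots> = (\<Sum>r\<in>R. \<Sum>i<n. cinner (X r i) (\<Sum>j<n. A i j (X r j)))"
      by (simp add: cinner_sum_right)
    also have "\<dots> \<in> \<real>\<^sub>\<ge>\<^sub>0"
    proof (induction R rule: infinite_finite_induct)
      case (insert r R)
      then show ?case
        using pos unfolding positive_op_matrix_def by (simp add: nonneg_Reals_add_I)
    qed auto
    finally show ?thesis .
  qed
  show ?thesis
    unfolding positive_op_matrix_def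
  proof
    fix \<xi> :: "nat \<Rightarrow> 'h2"
    have "\<xi> i \<in> closure S" for i
      using V2.total by (simp add: S_def)
    then have "\<exists>u. \<forall>i. (\<forall>m. u i m \<in> S) \<and> u i \<longlonglongrightarrow> \<xi> i"
      unfolding closure_sequential by (intro choice allI)
    then obtain u where "\<forall>i. (\<forall>m. u i m \<in> S) \<and> u i \<longlonglongrightarrow> \<xi> i" ..
    then have u: "\<And>i m. u i m \<in> S" "\<And>i. u i \<longlonglongrightarrow> \<xi> i" by simp_all
    have inner: "(\<lambda>m. \<Sum>j<n. gamma (A i j) (u j m)) \<longlonglongrightarrow> (\<Sum>j<n. gamma (A i j) (\<xi> j))"
      if "i < n" for i
    proof (rule tendsto_sum)
      fix j assume "j \<in> {..<n}"
      then have "bounded_op (gamma (A i j))" using that by (intro bounded_op_gamma A) auto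
      then show "(\<lambda>m. gamma (A i j) (u j m)) \<longlonglongrightarrow> gamma (A i j) (\<xi> j)"
        by (rule bounded_op_tendsto [OF _ u(2)])
    qed
    have lim: "(\<lambda>m. \<Sum>i<n. cinner (u i m) (\<Sum>j<n. gamma (A i j) (u j m)))
        \<longlonglongrightarrow> (\<Sum>i<n. cinner (\<xi> i) (\<Sum>j<n. gamma (A i j) (\<xi> j)))"
      by (rule tendsto_sum, rule bounded_bilinear.tendsto [OF bounded_bilinear_cinner u(2) inner]) simp
    have "(\<Sum>i<n. cinner (u i m) (\<Sum>j<n. gamma (A i j) (u j m))) \<in> \<real>\<^sub>\<ge>\<^sub>0" for m
      using on_span [of "\<lambda>i. u i m"] u(1) by blast
    then show "(\<Sum>i<n. cinner (\<xi> i) (\<Sum>j<n. gamma (A i j) (\<xi> j))) \<in> \<real>\<^sub>\<ge>\<^sub>0"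
      by (rule closed_sequentially [OF closed_nonneg_Reals_complex _ lim])
  qed
qed

text \<open>The vacuum is the coherent vector at 0, where the kernel is 1.\<close>

lemma vacuum_state_gamma:
  assumes "bounded_op A" shows "vacuum_state \<Omega>2 (gamma A) = vacuum_state \<Omega>1 A"
proof -
  have "D 0 = 0" using bounded_op_diff [OF D_bounded, of 0 0] by simp
  then show ?thesis
    using cinner_gamma [OF assms, of 0 0]
    by (simp add: vacuum_state_def V1.W_zero V2.W_zero form_def)
qed

section \<open>Characterization of \<open>\<Gamma>\<^sub>0\<close> and \<Gamma>\<close>

lemma weyl_algebra_bounded: "A \<in> weyl_algebra W1 \<Longrightarrow> bounded_op A"
  unfolding V1.weyl_algebra_eq_strong_closure by (rule V1.strong_closure_weyl_bounded)

lemma weyl_span_subset: "A \<in> weyl_span W1 \<Longrightarrow> A \<in> weyl_algebra W1"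
  unfolding V1.weyl_algebra_eq_strong_closure by (rule strong_closure.base)

lemma strongly_continuous_gamma:
  assumes "\<And>A. A \<in> \<A> \<Longrightarrow> bounded_op A"
  shows "strongly_continuous_on \<A> (restrict gamma \<A>)"
  unfolding strongly_continuous_on_def
  using strongly_tendsto_gamma assms by simp

text \<open>Stated as an equivalence, so that existence and uniqueness follow together. The
  prescribed values propagate linearly from the Weyl operators to the span, and extensionality fixes
  the rest.\<close>

lemma is_Gamma0_iff: "is_Gamma0 W1 W2 C G0 \<longleftrightarrow> G0 = restrict gamma (weyl_span W1)"
proof
  assume "is_Gamma0 W1 W2 C G0"
  then have G0: "G0 \<in> weyl_span W1 \<rightarrow>\<^sub>E weyl_span W2"
    and add: "\<And>A B. A \<in> weyl_span W1 \<Longrightarrow> B \<in> weyl_span W1 \<Longrightarrow> G0 (A + B) = G0 A + G0 B"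
    and scale: "\<And>a A. A \<in> weyl_span W1 \<Longrightarrow> G0 (a *\<^sub>C A) = a *\<^sub>C G0 A"
    and G0_W1: "\<And>f. G0 (W1 f) = gamma (W1 f)"
    by (auto simp: is_Gamma0_def op_linear_on_def gamma_W1)
  note sub = V1.csubspace_weyl_span
  have zero: "G0 0 = 0" "gamma 0 = 0"
    using scale [OF complex_vector.subspace_0 [OF sub], of 0] gamma_scaleC [OF bounded_op_zero, of 0]
    by (simp_all only: complex_vector.scale_zero_left)
  have "A \<in> weyl_span W1 \<and> G0 A = gamma A" if "A \<in> weyl_span W1" for A
    using that
  proof (induction rule: V1.weyl_span_induct)
    case (W f) show ?case using G0_W1 V1.W_in_weyl_span by blast
  next
    case subspace
    show ?case
      unfolding complex_vector.subspace_def mem_Collect_eq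
      by (intro conjI ballI allI)
        (auto simp only: zero add scale gamma_plus gamma_scaleC V1.weyl_span_bounded
          intro: complex_vector.subspace_0 [OF sub] complex_vector.subspace_add [OF sub]
            complex_vector.subspace_scale [OF sub])
  qed
  then show "G0 = restrict gamma (weyl_span W1)"
    using G0 by (intro extensionalityI [where A = "weyl_span W1"]) (auto simp: PiE_def)
next
  have plus: "gamma (A + B) = gamma A + gamma B" if "A \<in> weyl_span W1" "B \<in> weyl_span W1" for A B
    using that by (intro gamma_plus V1.weyl_span_bounded)
  have scale: "gamma (a *\<^sub>C A) = a *\<^sub>C gamma A" if "A \<in> weyl_span W1" for a A
    using that by (intro gamma_scaleC V1.weyl_span_bounded)
  assume G0: "G0 = restrict gamma (weyl_span W1)"
  show "is_Gamma0 W1 W2 C G0"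
    unfolding is_Gamma0_def op_linear_on_def G0
  proof (intro conjI ballI allI)
    show "restrict gamma (weyl_span W1) \<in> weyl_span W1 \<rightarrow>\<^sub>E weyl_span W2"
      using gamma_weyl_span by auto
  qed (simp_all only: restrict_apply' plus scale V1.W_in_weyl_span gamma_W1
      complex_vector.subspace_add [OF V1.csubspace_weyl_span]
      complex_vector.subspace_scale [OF V1.csubspace_weyl_span])
qed

text \<open>Uniqueness is an induction along the strong closure: G and \<open>gamma\<close> agree on
  the span, and both send strong limits to strong limits.\<close>

lemma is_strongly_continuous_extension_iff:
  "is_strongly_continuous_extension W1 W2 (restrict gamma (weyl_span W1)) G
    \<longleftrightarrow> G = restrict gamma (weyl_algebra W1)"
proof
  assume "is_strongly_continuous_extension W1 W2 (restrict gamma (weyl_span W1)) G"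
  then have G: "G \<in> weyl_algebra W1 \<rightarrow>\<^sub>E weyl_algebra W2"
    and cont: "strongly_continuous_on (weyl_algebra W1) G"
    and eq: "\<And>A. A \<in> weyl_span W1 \<Longrightarrow> G A = gamma A"
    by (auto simp: is_strongly_continuous_extension_def)
  have "G A = gamma A" if "A \<in> strong_closure (weyl_span W1)" for A
    using that
  proof (induction rule: strong_closure_induct)
    case (base A) then show ?case by (rule eq)
  next
    case (limit X A)
    have bX: "bounded_op (X n)" for n
      using limit.hyps(1) by (rule V1.strong_closure_weyl_bounded)
    have "A \<in> strong_closure (weyl_span W1)"
      by (rule strong_closure.limit [OF _ limit.hyps(2,3)]) (use limit.hyps(1) in blast)
    then have "strongly_tendsto (\<lambda>n. G (X n)) (G A)"
      using cont limit.hyps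
      unfolding strongly_continuous_on_def V1.weyl_algebra_eq_strong_closure by blast
    then have "strongly_tendsto (\<lambda>n. gamma (X n)) (G A)"
      by (simp only: limit.IH)
    moreover have "strongly_tendsto (\<lambda>n. gamma (X n)) (gamma A)"
      by (rule strongly_tendsto_gamma [OF bX limit.hyps(2,3)])
    ultimately show ?case by (rule strongly_tendsto_unique)
  qed
  then show "G = restrict gamma (weyl_algebra W1)"
    using G unfolding V1.weyl_algebra_eq_strong_closure
    by (intro extensionalityI [where A = "strong_closure (weyl_span W1)"]) (auto simp: PiE_def)
next
  assume G: "G = restrict gamma (weyl_algebra W1)"
  show "is_strongly_continuous_extension W1 W2 (restrict gamma (weyl_span W1)) G"
    unfolding is_strongly_continuous_extension_def G
  proof (intro conjI ballI)
    show "restrict gamma (weyl_algebra W1) \<in> weyl_algebra W1 \<rightarrow>\<^sub>E weyl_algebra W2"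
      using gamma_weyl_algebra by auto
    show "strongly_continuous_on (weyl_algebra W1) (restrict gamma (weyl_algebra W1))"
      by (intro strongly_continuous_gamma weyl_algebra_bounded)
  qed (simp only: restrict_apply' weyl_span_subset)
qed

lemma operation_gamma:
  "operation (weyl_algebra W1) (vacuum_state \<Omega>1) (weyl_algebra W2) (vacuum_state \<Omega>2)
    (restrict gamma (weyl_algebra W1))"
proof -
  have sub: "csubspace (weyl_algebra W1)"
    unfolding V1.weyl_algebra_eq_strong_closure
    by (intro csubspace_strong_closure V1.csubspace_weyl_span V1.weyl_span_bounded)
  have id: "id \<in> weyl_algebra W1"
    using weyl_span_subset [OF V1.W_in_weyl_span [of 0]] by (simp only: V1.W_zero)
  have plus: "gamma (A + B) = gamma A + gamma B" if "A \<in> weyl_algebra W1" "B \<in> weyl_algebra W1" for A B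
    using that by (intro gamma_plus weyl_algebra_bounded)
  have scale: "gamma (a *\<^sub>C A) = a *\<^sub>C gamma A" if "A \<in> weyl_algebra W1" for a A
    using that by (intro gamma_scaleC weyl_algebra_bounded)
  show ?thesis
    unfolding operation_def op_linear_on_def
  proof (intro conjI ballI allI)
    show "restrict gamma (weyl_algebra W1) \<in> weyl_algebra W1 \<rightarrow> weyl_algebra W2"
      using gamma_weyl_algebra by auto
    show "strongly_continuous_on (weyl_algebra W1) (restrict gamma (weyl_algebra W1))"
      by (intro strongly_continuous_gamma weyl_algebra_bounded)
    show "completely_positive_on (weyl_algebra W1) (restrict gamma (weyl_algebra W1))"
      unfolding completely_positive_on_def
    proof (intro allI impI)
      fix n and A :: "nat \<Rightarrow> nat \<Rightarrow> 'h1 \<Rightarrow> 'h1"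
      assume A: "(\<forall>i<n. \<forall>j<n. A i j \<in> weyl_algebra W1) \<and> positive_op_matrix n A"
      then have "positive_op_matrix n (\<lambda>i j. gamma (A i j))"
        by (intro gamma_completely_positive weyl_algebra_bounded) auto
      then show "positive_op_matrix n (\<lambda>i j. restrict gamma (weyl_algebra W1) (A i j))"
        using A by (simp add: positive_op_matrix_def)
    qed
  qed (simp_all only: restrict_apply' plus scale id gamma_id weyl_algebra_bounded vacuum_state_gamma
      complex_vector.subspace_add [OF sub] complex_vector.subspace_scale [OF sub])
qed

end

theorem theorem2p5:
  fixes W1 :: "'k1::chilbert_space \<Rightarrow> 'h1::chilbert_space \<Rightarrow> 'h1"
    and W2 :: "'k2::chilbert_space \<Rightarrow> 'h2::chilbert_space \<Rightarrow> 'h2"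
    and \<Omega>1 :: 'h1 and \<Omega>2 :: 'h2
    and C :: "'k1 \<Rightarrow> 'k2"
  assumes "cyclic_vacuum_representation W1 \<Omega>1"
    and "cyclic_vacuum_representation W2 \<Omega>2"
    and "contraction C"
  shows "(\<exists>!G0. is_Gamma0 W1 W2 C G0) \<and>
    (\<forall>G0. is_Gamma0 W1 W2 C G0 \<longrightarrow>
       strongly_continuous_on (weyl_span W1) G0 \<and>
       (\<exists>!G. is_strongly_continuous_extension W1 W2 G0 G) \<and>
       (\<forall>G. is_strongly_continuous_extension W1 W2 G0 G \<longrightarrow>
          operation (weyl_algebra W1) (vacuum_state \<Omega>1)
                    (weyl_algebra W2) (vacuum_state \<Omega>2) G))"
proof -
  have C: "bounded_op C" "\<And>x. norm (C x) \<le> 1 * norm x"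
    using assms(3) by (auto simp: contraction_def bounded_op_def intro: exI [of _ 1])
  \<comment> \<open>The adjoint is again a contraction, since \<open>adjoint_exists\<close> keeps
    the constant 1.\<close>
  obtain D where D: "bounded_op D" "\<And>x y. cinner (D x) y = cinner x (C y)"
      "\<And>x. norm (D x) \<le> 1 * norm x"
    using adjoint_exists [OF C(1) zero_le_one C(2)] by blast
  interpret second_quantization W1 \<Omega>1 W2 \<Omega>2 C D
    by unfold_locales (use assms D in auto)
  show ?thesis
    unfolding is_Gamma0_iff
    using is_strongly_continuous_extension_iff operation_gamma
      strongly_continuous_gamma [OF V1.weyl_span_bounded]
    by simp
qed

end
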